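(* For $n\ge 1$ let $\pi_n=\begin{pmatrix}1\\ n\end{pmatrix}\in\mathbf{S}$ be the biword of length one with bottom entry $n$. Then the family $(\pi_n)_{n\geq 1}$ is a basis of the space of dendriform primitive elements $\mathrm{Ker}(\Delta_\prec)\cap\mathrm{Ker}(\Delta_\succ)\cap \mathbf{Descd}_+$ of the dendriform descent algebra $\mathbf{Descd}$, and these elements freely generate $\mathbf{Descd}$ as a dendriform algebra (i.e. the augmentation ideal $\mathbf{Descd}_+$ is the free dendriform algebra on the $\pi_n$, $n\ge 1$).
   Context: The ground field is $\mathbf{Q}$, $\mathbb{N}^*=\{1,2,\dots\}$, $[k]=\{1,\dots,k\}$. Dendriform algebra: a vector space with two bilinear products $\prec,\succ$ such that, with $\ast=\prec+\succ$, $(x\prec y)\prec z=x\prec(y\ast z)$, $(x\succ y)\prec z=x\succ(y\prec z)$, $(x\ast y)\succ z=x\succ(y\succ z)$. Graded permutations: $\mathbf{S}$ is the vector space with basis the pairs $(\sigma,d)$, $\sigma\in\mathfrak{S}_k$, $d:[k]\to\mathbb{N}^*$, $k\ge 0$. The pair $(\sigma,d)$ is written as the biword $\begin{pmatrix}\sigma(1)&\ldots&\sigma(k)\\ d(1)&\ldots&d(k)\end{pmatrix}$ and has weight $d(1)+\dots+d(k)$. Let $1$ be the empty biword ($k=0$) and $\mathbf{S}_+$ the span of the biwords with $k\ge 1$. For $(\sigma,d)$ of length $k\ge1$ and $(\tau,e)$ of length $l\ge1$, $$(\sigma,d)\prec(\tau,e)=\sum_{\alpha}((\sigma\otimes\tau)\circ\alpha^{-1},(d\otimes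 e)\circ\alpha^{-1}),$$ the sum being over permutations $\alpha\in \mathfrak{S}_{k+l}$ with $\alpha(1)<\dots<\alpha(k)$, $\alpha(k+1)<\dots<\alpha(k+l)$ and $\alpha^{-1}(1)=1$; $(\sigma,d)\succ(\tau,e)$ is the same sum with $\alpha^{-1}(1)=k+1$ instead. Here $(\sigma\otimes\tau)(i)=\sigma(i)$ for $i\le k$, $(\sigma\otimes\tau)(i)=\tau(i-k)+k$ for $i>k$, and $(d\otimes e)(i)=d(i)$ for $i\le k$, $(d\otimes e)(i)=e(i-k)$ for $i>k$. With these products $\mathbf{S}_+$ is a dendriform algebra. One extends to the unit by $x\prec 1=x=1\succ x$, $1\prec x=x\succ 1=0$ for $x\in\mathbf{S}_+$, $1\prec 1=1\succ 1=0$; the associative product is $\star=\prec+\succ$ on $\mathbf{S}_+$, with unit $1$. Coproducts on $\mathbf{S}_+$: for $(\sigma,d)$ with $\sigma\in\mathfrak{S}_n$, $n\ge1$, $$\Delta_\prec((\sigma,d))=\sum_{i=\sigma^{-1}(1)}^{n-1}\begin{pmatrix}std(\sigma(1),\ldots,\sigma(i))\\ d(1),\ldots,d(i)\end{pmatrix}\otimes\begin{pmatrix}std(\sigma(i+1),\ldots,\sigma(n))\\ d(i+1),\ldots,d(n)\end{pmatrix},$$ and $\Delta_\succ((\sigma,d))$ is the same sum over $1\le i\le\sigma^{-1}(1)-1$. Here $std(i_1,\dots,i_k)=(f(i_1),\dots,f(i_k))$, $f$ being the increasing bijection $\{i_1,\dots,i_k\}\to[k]$. Dendriform descent algebra: for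 $n\ge1$, $p_n=\sum_{k=1}^n\sum_{d(1)+\dots+d(k)=n}\begin{pmatrix}1&\ldots&k\\ d(1)&\ldots&d(k)\end{pmatrix}$ (sum over $d:[k]\to\mathbb{N}^*$), and $p_0=1$. $\mathbf{Descd}\subseteq\mathbf{S}$ is the dendriform subalgebra generated by the $p_n$, $n\ge 0$; thus $\mathbf{Descd}=\mathbf{Q}1\oplus\mathbf{Descd}_+$, with $\mathbf{Descd}_+\subseteq \mathbf{S}_+$ the dendriform subalgebra generated by the $p_n$, $n\ge 1$. ($\Delta_\prec$ and $\Delta_\succ$ restrict to $\mathbf{Descd}_+$.) *)

theory Defs
  imports Complex_Main "HOL-Combinatorics.Permutations" "HOL-Library.Poly_Mapping"
begin

section \<open>Dendriform algebras over the rationals\<close>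

text \<open>The underlying space is a subspace \<open>A\<close> of an ambient rational vector space, so that
  subalgebras are dendriform algebras in the same sense.\<close>

locale dendriform_algebra = vector_space scale
  for scale :: "rat \<Rightarrow> 'a::ab_group_add \<Rightarrow> 'a" +
  fixes A :: "'a set"
    and lt :: "'a \<Rightarrow> 'a \<Rightarrow> 'a" (infixl \<open>\<prec>\<close> 70)
    and gt :: "'a \<Rightarrow> 'a \<Rightarrow> 'a" (infixl \<open>\<succ>\<close> 70)
  assumes subspace_A: "subspace A"
    and lt_closed: "\<lbrakk>x \<in> A; y \<in> A\<rbrakk> \<Longrightarrow> x \<prec> y \<in> A"
    and gt_closed: "\<lbrakk>x \<in> A; y \<in> A\<rbrakk> \<Longrightarrow> x \<succ> y \<in> A"
    and lt_add_left: "\<lbrakk>x \<in> A; y \<in> A; z \<in> A\<rbrakk> \<Longrightarrow> (x + y) \<prec> z = x \<prec> z + y \<prec> z"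
    and lt_add_right: "\<lbrakk>x \<in> A; y \<in> A; z \<in> A\<rbrakk> \<Longrightarrow> x \<prec> (y + z) = x \<prec> y + x \<prec> z"
    and lt_scale_left: "\<lbrakk>x \<in> A; y \<in> A\<rbrakk> \<Longrightarrow> scale c x \<prec> y = scale c (x \<prec> y)"
    and lt_scale_right: "\<lbrakk>x \<in> A; y \<in> A\<rbrakk> \<Longrightarrow> x \<prec> scale c y = scale c (x \<prec> y)"
    and gt_add_left: "\<lbrakk>x \<in> A; y \<in> A; z \<in> A\<rbrakk> \<Longrightarrow> (x + y) \<succ> z = x \<succ> z + y \<succ> z"
    and gt_add_right: "\<lbrakk>x \<in> A; y \<in> A; z \<in> A\<rbrakk> \<Longrightarrow> x \<succ> (y + z) = x \<succ> y + x \<succ> z"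
    and gt_scale_left: "\<lbrakk>x \<in> A; y \<in> A\<rbrakk> \<Longrightarrow> scale c x \<succ> y = scale c (x \<succ> y)"
    and gt_scale_right: "\<lbrakk>x \<in> A; y \<in> A\<rbrakk> \<Longrightarrow> x \<succ> scale c y = scale c (x \<succ> y)"
    and lt_lt: "\<lbrakk>x \<in> A; y \<in> A; z \<in> A\<rbrakk> \<Longrightarrow> (x \<prec> y) \<prec> z = x \<prec> (y \<prec> z + y \<succ> z)"
    and gt_lt: "\<lbrakk>x \<in> A; y \<in> A; z \<in> A\<rbrakk> \<Longrightarrow> (x \<succ> y) \<prec> z = x \<succ> (y \<prec> z)"
    and gt_gt: "\<lbrakk>x \<in> A; y \<in> A; z \<in> A\<rbrakk> \<Longrightarrow> (x \<prec> y + x \<succ> y) \<succ> z = x \<succ> (y \<succ> z)"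

locale dendriform_hom =
  dom: dendriform_algebra scaleA A ltA gtA +
  cod: dendriform_algebra scaleB B ltB gtB
  for scaleA :: "rat \<Rightarrow> 'a::ab_group_add \<Rightarrow> 'a" and A ltA gtA
    and scaleB :: "rat \<Rightarrow> 'b::ab_group_add \<Rightarrow> 'b" and B ltB gtB +
  fixes f :: "'a \<Rightarrow> 'b"
  assumes hom_in: "x \<in> A \<Longrightarrow> f x \<in> B"
    and hom_add: "\<lbrakk>x \<in> A; y \<in> A\<rbrakk> \<Longrightarrow> f (x + y) = f x + f y"
    and hom_scale: "x \<in> A \<Longrightarrow> f (scaleA c x) = scaleB c (f x)"
    and hom_lt: "\<lbrakk>x \<in> A; y \<in> A\<rbrakk> \<Longrightarrow> f (ltA x y) = ltB (f x) (f y)"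
    and hom_gt: "\<lbrakk>x \<in> A; y \<in> A\<rbrakk> \<Longrightarrow> f (gtA x y) = gtB (f x) (f y)"

text \<open>\<open>A\<close> is free on the family \<open>(x i)\<close>, \<open>i \<in> I\<close>: the universal property, tested on all
  dendriform algebras carried by a subset of the type \<open>'b\<close>. A statement in which \<open>'b\<close> is a
  free type variable thus covers all dendriform algebras. Homomorphisms are unique as
  functions on \<open>A\<close>; their values outside \<open>A\<close> are irrelevant.\<close>

definition free_dendriform_on ::
  "'b::ab_group_add itself \<Rightarrow> (rat \<Rightarrow> 'a::ab_group_add \<Rightarrow> 'a) \<Rightarrow> 'a set \<Rightarrow>
   ('a \<Rightarrow> 'a \<Rightarrow> 'a) \<Rightarrow> ('a \<Rightarrow> 'a \<Rightarrow> 'a) \<Rightarrow> 'i set \<Rightarrow> ('i \<Rightarrow> 'a) \<Rightarrow> bool" where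
  "free_dendriform_on _ scaleA A ltA gtA I x \<longleftrightarrow>
     dendriform_algebra scaleA A ltA gtA \<and>
     (\<forall>i\<in>I. x i \<in> A) \<and>
     (\<forall>scaleB (B :: 'b set) ltB gtB b.
        dendriform_algebra scaleB B ltB gtB \<and> (\<forall>i\<in>I. b i \<in> B) \<longrightarrow>
        (\<exists>f. dendriform_hom scaleA A ltA gtA scaleB B ltB gtB f \<and> (\<forall>i\<in>I. f (x i) = b i) \<and>
             (\<forall>g. dendriform_hom scaleA A ltA gtA scaleB B ltB gtB g \<and> (\<forall>i\<in>I. g (x i) = b i) \<longrightarrow>
                  (\<forall>a\<in>A. g a = f a))))"


section \<open>Finitely supported families as rational vector spaces\<close>

definition qscale :: "rat \<Rightarrow> ('a \<Rightarrow>\<^sub>0 rat) \<Rightarrow> ('a \<Rightarrow>\<^sub>0 rat)" where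
  "qscale c x = Poly_Mapping.map ((*) c) x"

lemma lookup_qscale [simp]: "Poly_Mapping.lookup (qscale c x) k = c * Poly_Mapping.lookup x k"
  by (simp add: qscale_def Poly_Mapping.map.rep_eq when_def)

global_interpretation fs: vector_space "qscale :: rat \<Rightarrow> ('a \<Rightarrow>\<^sub>0 rat) \<Rightarrow> ('a \<Rightarrow>\<^sub>0 rat)"
  by unfold_locales (auto intro!: poly_mapping_eqI simp: lookup_add algebra_simps)

definition linear_ext :: "('a \<Rightarrow> ('b \<Rightarrow>\<^sub>0 rat)) \<Rightarrow> ('a \<Rightarrow>\<^sub>0 rat) \<Rightarrow> ('b \<Rightarrow>\<^sub>0 rat)" where
  "linear_ext h x = (\<Sum>u\<in>Poly_Mapping.keys x. qscale (Poly_Mapping.lookup x u) (h u))"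

definition bilinear_ext ::
  "('a \<Rightarrow> 'a \<Rightarrow> ('b \<Rightarrow>\<^sub>0 rat)) \<Rightarrow> ('a \<Rightarrow>\<^sub>0 rat) \<Rightarrow> ('a \<Rightarrow>\<^sub>0 rat) \<Rightarrow> ('b \<Rightarrow>\<^sub>0 rat)" where
  "bilinear_ext h x y = linear_ext (\<lambda>u. linear_ext (\<lambda>v. h u v) y) x"


section \<open>Graded permutations\<close>

typedef biword =
  "{(s :: nat list, d :: nat list).
     distinct s \<and> set s = {1..length s} \<and> length d = length s \<and> 0 \<notin> set d}"
  morphisms rep_biword Biword
  by (rule exI[of _ "([], [])"]) auto

setup_lifting type_definition_biword

abbreviation top_row :: "biword \<Rightarrow> nat list" where "top_row u \<equiv> fst (rep_biword u)"
abbreviation bottom_row :: "biword \<Rightarrow> nat list" where "bottom_row u \<equiv> snd (rep_biword u)"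

definition bw_length :: "biword \<Rightarrow> nat" where
  "bw_length u = length (top_row u)"

definition empty_biword :: biword where
  "empty_biword = Biword ([], [])"

type_synonym graded_perms = "biword \<Rightarrow>\<^sub>0 rat"

abbreviation basis_elt :: "'a \<Rightarrow> ('a \<Rightarrow>\<^sub>0 rat)" where
  "basis_elt u \<equiv> Poly_Mapping.single u 1"

definition unit_elt :: graded_perms where
  "unit_elt = basis_elt empty_biword"

definition S_plus :: "graded_perms set" where
  "S_plus = fs.span {basis_elt u |u. bw_length u \<ge> 1}"


subsection \<open>Half-shuffle products\<close>

text \<open>Positions are numbered from \<open>0\<close>, letters from \<open>1\<close>. With \<open>xs\<close> regarded as a function of
  positions, \<open>permute_list (inv \<alpha>) xs\<close> is \<open>xs \<circ> \<alpha>\<inverse>\<close>.\<close>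

definition shuffle_perms :: "nat \<Rightarrow> nat \<Rightarrow> (nat \<Rightarrow> nat) set" where
  "shuffle_perms k l =
     {\<alpha>. \<alpha> permutes {..<k + l} \<and> strict_mono_on {..<k} \<alpha> \<and> strict_mono_on {k..<k + l} \<alpha>}"

definition shuffle_biword :: "biword \<Rightarrow> biword \<Rightarrow> (nat \<Rightarrow> nat) \<Rightarrow> biword" where
  "shuffle_biword u v \<alpha> =
     Biword (permute_list (inv \<alpha>) (top_row u @ map (\<lambda>j. j + bw_length u) (top_row v)),
             permute_list (inv \<alpha>) (bottom_row u @ bottom_row v))"

definition lt_bw :: "biword \<Rightarrow> biword \<Rightarrow> graded_perms" where
  "lt_bw u v =
     (if bw_length u = 0 then 0
      else if bw_length v = 0 then basis_elt u
      else \<Sum>\<alpha>\<in>{\<alpha> \<in> shuffle_perms (bw_length u) (bw_length v). inv \<alpha> 0 = 0}.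
             basis_elt (shuffle_biword u v \<alpha>))"

definition gt_bw :: "biword \<Rightarrow> biword \<Rightarrow> graded_perms" where
  "gt_bw u v =
     (if bw_length v = 0 then 0
      else if bw_length u = 0 then basis_elt v
      else \<Sum>\<alpha>\<in>{\<alpha> \<in> shuffle_perms (bw_length u) (bw_length v). inv \<alpha> 0 = bw_length u}.
             basis_elt (shuffle_biword u v \<alpha>))"

definition S_lt :: "graded_perms \<Rightarrow> graded_perms \<Rightarrow> graded_perms" where
  "S_lt = bilinear_ext lt_bw"

definition S_gt :: "graded_perms \<Rightarrow> graded_perms \<Rightarrow> graded_perms" where
  "S_gt = bilinear_ext gt_bw"


subsection \<open>Half-coproducts\<close>

text \<open>The increasing bijection from a finite set \<open>A\<close> of size \<open>k\<close> onto \<open>{1..k}\<close> sends \<open>x\<close> to the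
  number of elements of \<open>A\<close> that are at most \<open>x\<close>.\<close>

definition std :: "nat list \<Rightarrow> nat list" where
  "std xs = map (\<lambda>x. card {y \<in> set xs. y \<le> x}) xs"

definition prefix_bw :: "nat \<Rightarrow> biword \<Rightarrow> biword" where
  "prefix_bw i u = Biword (std (take i (top_row u)), take i (bottom_row u))"

definition suffix_bw :: "nat \<Rightarrow> biword \<Rightarrow> biword" where
  "suffix_bw i u = Biword (std (drop i (top_row u)), drop i (bottom_row u))"

text \<open>\<open>\<sigma>\<inverse>(1)\<close>, counting positions from \<open>1\<close>.\<close>

definition pos_one :: "biword \<Rightarrow> nat" where
  "pos_one u = Suc (inv_into {..<bw_length u} ((!) (top_row u)) 1)"

text \<open>The tensor square of the space with basis \<open>biword\<close> is the space with basis
  \<open>biword \<times> biword\<close>. The coproducts are meaningful on \<open>S_plus\<close> only.\<close>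

definition delta_lt_bw :: "biword \<Rightarrow> (biword \<times> biword) \<Rightarrow>\<^sub>0 rat" where
  "delta_lt_bw u = (\<Sum>i\<in>{pos_one u..<bw_length u}. basis_elt (prefix_bw i u, suffix_bw i u))"

definition delta_gt_bw :: "biword \<Rightarrow> (biword \<times> biword) \<Rightarrow>\<^sub>0 rat" where
  "delta_gt_bw u = (\<Sum>i\<in>{1..<pos_one u}. basis_elt (prefix_bw i u, suffix_bw i u))"

definition delta_lt :: "graded_perms \<Rightarrow> ((biword \<times> biword) \<Rightarrow>\<^sub>0 rat)" where
  "delta_lt = linear_ext delta_lt_bw"

definition delta_gt :: "graded_perms \<Rightarrow> ((biword \<times> biword) \<Rightarrow>\<^sub>0 rat)" where
  "delta_gt = linear_ext delta_gt_bw"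


section \<open>The dendriform descent algebra\<close>

definition p_elt :: "nat \<Rightarrow> graded_perms" where
  "p_elt n =
     (if n = 0 then unit_elt
      else \<Sum>k = 1..n. \<Sum>d\<in>{d. length d = k \<and> 0 \<notin> set d \<and> sum_list d = n}.
             basis_elt (Biword ([1..<Suc k], d)))"

definition dendriform_span :: "graded_perms set \<Rightarrow> graded_perms set" where
  "dendriform_span X =
     \<Inter>{V. X \<subseteq> V \<and> fs.subspace V \<and> (\<forall>x\<in>V. \<forall>y\<in>V. S_lt x y \<in> V \<and> S_gt x y \<in> V)}"

definition Descd :: "graded_perms set" where
  "Descd = dendriform_span (range p_elt)"

definition Descd_plus :: "graded_perms set" where
  "Descd_plus = dendriform_span (p_elt ` {1..})"

definition pi_elt :: "nat \<Rightarrow> graded_perms" where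
  "pi_elt n = basis_elt (Biword ([1], [n]))"


section \<open>Well-formedness\<close>

lemma rep_biword_cases:
  "distinct (top_row u)" "set (top_row u) = {1..bw_length u}"
  "length (bottom_row u) = bw_length u" "0 \<notin> set (bottom_row u)"
  using rep_biword[of u] by (auto simp: bw_length_def)

lemma rep_empty_biword: "rep_biword empty_biword = ([], [])"
  unfolding empty_biword_def by (rule Biword_inverse) auto

lemma bw_length_eq_0_iff: "bw_length u = 0 \<longleftrightarrow> u = empty_biword"
proof
  assume "bw_length u = 0"
  then have "rep_biword u = ([], [])"
    using rep_biword_cases(3)[of u] by (simp add: bw_length_def prod_eq_iff)
  then show "u = empty_biword"
    by (metis rep_biword_inject rep_empty_biword)
qed (simp add: bw_length_def rep_empty_biword)

lemma rep_pi_biword: "n \<ge> 1 \<Longrightarrow> rep_biword (Biword ([1], [n])) = ([1], [n])"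
  by (rule Biword_inverse) auto

lemma rep_p_biword:
  assumes "length d = k" "0 \<notin> set d"
  shows "rep_biword (Biword ([1..<Suc k], d)) = ([1..<Suc k], d)"
  using assms by (intro Biword_inverse) auto

lemma finite_compositions: "finite {d :: nat list. length d = k \<and> 0 \<notin> set d \<and> sum_list d = n}"
  by (rule finite_subset[OF _ finite_lists_length_eq[of "{..n}" k]])
     (auto simp: member_le_sum_list)

lemma rep_shuffle_biword:
  assumes "\<alpha> \<in> shuffle_perms (bw_length u) (bw_length v)"
  shows "rep_biword (shuffle_biword u v \<alpha>) =
     (permute_list (inv \<alpha>) (top_row u @ map (\<lambda>j. j + bw_length u) (top_row v)),
      permute_list (inv \<alpha>) (bottom_row u @ bottom_row v))"
proof -
  let ?s = "top_row u @ map (\<lambda>j. j + bw_length u) (top_row v)"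
  let ?d = "bottom_row u @ bottom_row v"
  have len: "length ?s = bw_length u + bw_length v" "length ?d = bw_length u + bw_length v"
    using rep_biword_cases(3) by (auto simp: bw_length_def)
  have per: "inv \<alpha> permutes {..<bw_length u + bw_length v}"
    using assms by (auto simp: shuffle_perms_def intro: permutes_inv)
  have sets: "set (permute_list (inv \<alpha>) ?s) = set ?s" "set (permute_list (inv \<alpha>) ?d) = set ?d"
    using per len by (auto simp del: set_append set_map simp: set_permute_list)
  have dist: "distinct (permute_list (inv \<alpha>) ?s) = distinct ?s"
    using per len by (intro distinct_permute_list) simp
  have "(\<lambda>j. j + bw_length u) ` {1..bw_length v} = {bw_length u + 1..bw_length u + bw_length v}"
    by (metis add.commute image_add_atLeastAtMost')
  then have "set ?s = {1..bw_length u} \<union> {bw_length u + 1..bw_length u + bw_length v}"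
    by (simp only: set_append set_map rep_biword_cases(2))
  also have "\<dots> = {1..bw_length u + bw_length v}"
    by auto
  finally have "set ?s = {1..bw_length u + bw_length v}" .
  moreover have "distinct ?s"
    using rep_biword_cases(1,2)[of u] rep_biword_cases(1,2)[of v]
    by (auto simp: distinct_map)
  moreover have "0 \<notin> set ?d"
    using rep_biword_cases(4) by auto
  ultimately show ?thesis
    unfolding shuffle_biword_def
    by (intro Biword_inverse) (simp only: mem_Collect_eq split sets dist length_permute_list len, simp)
qed

lemma std_bij:
  fixes xs :: "nat list"
  shows "strict_mono_on (set xs) (\<lambda>x. card {y \<in> set xs. y \<le> x})"
    and "bij_betw (\<lambda>x. card {y \<in> set xs. y \<le> x}) (set xs) {1..card (set xs)}"
proof -
  show mono: "strict_mono_on (set xs) (\<lambda>x. card {y \<in> set xs. y \<le> x})"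
  proof (rule strict_mono_onI)
    fix r s assume "r \<in> set xs" "s \<in> set xs" "r < s"
    then have "{y \<in> set xs. y \<le> r} \<subseteq> {y \<in> set xs. y \<le> s}"
      and "s \<in> {y \<in> set xs. y \<le> s} - {y \<in> set xs. y \<le> r}"
      by auto
    then have "{y \<in> set xs. y \<le> r} \<subset> {y \<in> set xs. y \<le> s}"
      by blast
    then show "card {y \<in> set xs. y \<le> r} < card {y \<in> set xs. y \<le> s}"
      by (intro psubset_card_mono) auto
  qed
  let ?f = "\<lambda>x. card {y \<in> set xs. y \<le> x}"
  have inj: "inj_on ?f (set xs)"
    using mono by (rule strict_mono_on_imp_inj_on)
  have sub: "?f ` set xs \<subseteq> {1..card (set xs)}"
    by (auto simp: Suc_le_eq card_gt_0_iff intro!: card_mono)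
  have "?f ` set xs = {1..card (set xs)}"
    by (rule card_subset_eq) (use sub inj in \<open>auto simp: card_image\<close>)
  with inj show "bij_betw ?f (set xs) {1..card (set xs)}"
    by (simp add: bij_betw_def)
qed

lemma std_perm:
  assumes "distinct xs"
  shows "distinct (std xs)" "set (std xs) = {1..length xs}" "length (std xs) = length xs"
  using std_bij(2)[of xs] assms
  by (auto simp: std_def distinct_map bij_betw_def distinct_card)

lemma rep_prefix_bw: "rep_biword (prefix_bw i u) = (std (take i (top_row u)), take i (bottom_row u))"
  unfolding prefix_bw_def
proof (rule Biword_inverse)
  show "(std (take i (top_row u)), take i (bottom_row u)) \<in>
    {(s, d). distinct s \<and> set s = {1..length s} \<and> length d = length s \<and> 0 \<notin> set d}"
    using std_perm[of "take i (top_row u)"] rep_biword_cases[of u]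
    by (auto simp: bw_length_def dest: in_set_takeD)
qed

lemma rep_suffix_bw: "rep_biword (suffix_bw i u) = (std (drop i (top_row u)), drop i (bottom_row u))"
  unfolding suffix_bw_def
proof (rule Biword_inverse)
  show "(std (drop i (top_row u)), drop i (bottom_row u)) \<in>
    {(s, d). distinct s \<and> set s = {1..length s} \<and> length d = length s \<and> 0 \<notin> set d}"
    using std_perm[of "drop i (top_row u)"] rep_biword_cases[of u]
    by (auto simp: bw_length_def dest: in_set_dropD)
qed

lemma pos_one:
  assumes "bw_length u \<ge> 1"
  shows "1 \<le> pos_one u" "pos_one u \<le> bw_length u" "top_row u ! (pos_one u - 1) = 1"
proof -
  have *: "1 \<in> (!) (top_row u) ` {..<bw_length u}"
    using rep_biword_cases(2)[of u] assms
    by (metis atLeastAtMost_iff bw_length_def image_eqI in_set_conv_nth lessThan_iff order_refl)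
  show "1 \<le> pos_one u" "pos_one u \<le> bw_length u" "top_row u ! (pos_one u - 1) = 1"
    using inv_into_into[OF *] f_inv_into_f[OF *] by (auto simp: pos_one_def)
qed


section \<open>The unit and the augmentation ideal\<close>

lemma linear_ext_superset:
  assumes "finite U" "Poly_Mapping.keys x \<subseteq> U"
  shows "linear_ext h x = (\<Sum>u\<in>U. qscale (Poly_Mapping.lookup x u) (h u))"
  unfolding linear_ext_def
  by (rule sum.mono_neutral_left) (use assms in \<open>auto simp: in_keys_iff\<close>)

lemma linear_ext_add: "linear_ext h (x + y) = linear_ext h x + linear_ext h y"
proof -
  let ?U = "Poly_Mapping.keys x \<union> Poly_Mapping.keys y"
  have "linear_ext h (x + y) = (\<Sum>u\<in>?U. qscale (Poly_Mapping.lookup (x + y) u) (h u))"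
    by (rule linear_ext_superset) (simp_all add: Poly_Mapping.keys_add)
  also have "\<dots> = (\<Sum>u\<in>?U. qscale (Poly_Mapping.lookup x u) (h u)) +
                   (\<Sum>u\<in>?U. qscale (Poly_Mapping.lookup y u) (h u))"
    by (simp add: lookup_add fs.scale_left_distrib sum.distrib)
  also have "\<dots> = linear_ext h x + linear_ext h y"
    by (simp add: linear_ext_superset[of ?U])
  finally show ?thesis .
qed

lemma linear_ext_scale: "linear_ext h (qscale c x) = qscale c (linear_ext h x)"
proof -
  have "linear_ext h (qscale c x) =
      (\<Sum>u\<in>Poly_Mapping.keys x. qscale (Poly_Mapping.lookup (qscale c x) u) (h u))"
    by (rule linear_ext_superset) (auto simp: in_keys_iff)
  then show ?thesis
    by (simp add: linear_ext_def fs.scale_sum_right)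
qed

lemma linear_ext_basis [simp]: "linear_ext h (basis_elt u) = h u"
  by (simp add: linear_ext_def)

lemma linear_ext_fun_add: "linear_ext (\<lambda>u. h u + h' u) x = linear_ext h x + linear_ext h' x"
  by (simp add: linear_ext_def fs.scale_right_distrib sum.distrib)

lemma linear_ext_fun_scale: "linear_ext (\<lambda>u. qscale c (h u)) x = qscale c (linear_ext h x)"
  by (simp add: linear_ext_def fs.scale_sum_right mult.commute)

lemma bilinear_ext_simps:
  "bilinear_ext h (x + x') y = bilinear_ext h x y + bilinear_ext h x' y"
  "bilinear_ext h x (y + y') = bilinear_ext h x y + bilinear_ext h x y'"
  "bilinear_ext h (qscale c x) y = qscale c (bilinear_ext h x y)"
  "bilinear_ext h x (qscale c y) = qscale c (bilinear_ext h x y)"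
  "bilinear_ext h (basis_elt u) (basis_elt v) = h u v"
  by (simp_all add: bilinear_ext_def linear_ext_add linear_ext_scale
      linear_ext_fun_add linear_ext_fun_scale)

lemma bilinear_ext_span:
  assumes "\<And>u v. \<lbrakk>u \<in> U; v \<in> V\<rbrakk> \<Longrightarrow> h u v \<in> W" "fs.subspace W"
    and "x \<in> fs.span (basis_elt ` U)" "y \<in> fs.span (basis_elt ` V)"
  shows "bilinear_ext h x y \<in> W"
proof -
  have zero: "bilinear_ext h 0 y = 0" "bilinear_ext h x 0 = 0" for x y
    by (simp_all add: bilinear_ext_def linear_ext_def)
  have "bilinear_ext h (basis_elt u) y \<in> W" if "u \<in> U" for u
    using assms(4)
    by (induction rule: fs.span_induct_alt)
       (use assms(1,2) that in \<open>auto simp: zero bilinear_ext_simps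
          intro!: fs.subspace_add fs.subspace_scale fs.subspace_0\<close>)
  with assms(3) show ?thesis
    by (induction rule: fs.span_induct_alt)
       (use assms(2) in \<open>auto simp: zero bilinear_ext_simps
          intro!: fs.subspace_add fs.subspace_scale fs.subspace_0\<close>)
qed

lemma S_plus_alt: "S_plus = fs.span (basis_elt ` {u. bw_length u \<ge> 1})"
  unfolding S_plus_def by (rule arg_cong[of _ _ fs.span]) auto

lemma subspace_S_plus: "fs.subspace S_plus"
  by (simp add: S_plus_def)

lemma basis_in_S_plus: "bw_length u \<ge> 1 \<Longrightarrow> basis_elt u \<in> S_plus"
  unfolding S_plus_def by (rule fs.span_base) auto

lemma bw_length_shuffle:
  assumes "\<alpha> \<in> shuffle_perms (bw_length u) (bw_length v)"
  shows "bw_length (shuffle_biword u v \<alpha>) = bw_length u + bw_length v"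
  by (simp add: bw_length_def rep_shuffle_biword[OF assms])

lemma S_plus_closed:
  assumes "x \<in> S_plus" "y \<in> S_plus"
  shows "S_lt x y \<in> S_plus" "S_gt x y \<in> S_plus"
proof -
  have "lt_bw u v \<in> S_plus" "gt_bw u v \<in> S_plus" if "bw_length u \<ge> 1" "bw_length v \<ge> 1" for u v
    using that unfolding lt_bw_def gt_bw_def
    by (auto intro!: fs.subspace_sum[OF subspace_S_plus] basis_in_S_plus simp: bw_length_shuffle)
  then show "S_lt x y \<in> S_plus" "S_gt x y \<in> S_plus"
    using assms unfolding S_lt_def S_gt_def S_plus_alt
    by (auto intro!: bilinear_ext_span[of "{u. bw_length u \<ge> 1}" "{u. bw_length u \<ge> 1}"])
qed

lemma S_unit:
  assumes "x \<in> S_plus"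
  shows "S_lt x unit_elt = x" "S_gt unit_elt x = x" "S_lt unit_elt x = 0" "S_gt x unit_elt = 0"
    and "S_lt unit_elt unit_elt = 0" "S_gt unit_elt unit_elt = 0"
proof -
  have zero: "bilinear_ext h 0 y = 0" "bilinear_ext h z 0 = 0"
    for h :: "biword \<Rightarrow> biword \<Rightarrow> graded_perms" and y z
    by (simp_all add: bilinear_ext_def linear_ext_def)
  have len: "bw_length empty_biword = 0"
    by (simp add: bw_length_eq_0_iff)
  note defs = S_lt_def S_gt_def unit_elt_def bilinear_ext_simps zero lt_bw_def gt_bw_def len
  show "S_lt unit_elt unit_elt = 0" "S_gt unit_elt unit_elt = 0"
    by (simp_all add: defs)
  have "S_lt x unit_elt = x \<and> S_gt unit_elt x = x \<and> S_lt unit_elt x = 0 \<and> S_gt x unit_elt = 0"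
    using assms unfolding S_plus_def
    by (induction rule: fs.span_induct_alt) (auto simp: defs)
  then show "S_lt x unit_elt = x" "S_gt unit_elt x = x" "S_lt unit_elt x = 0" "S_gt x unit_elt = 0"
    by auto
qed

lemma p_elt_in_S_plus:
  assumes "n \<ge> 1"
  shows "p_elt n \<in> S_plus"
proof -
  have "basis_elt (Biword ([1..<Suc k], d)) \<in> S_plus"
    if "k \<in> {1..n}" "d \<in> {d. length d = k \<and> 0 \<notin> set d \<and> sum_list d = n}" for k d
  proof (rule basis_in_S_plus)
    have "rep_biword (Biword ([1..<Suc k], d)) = ([1..<Suc k], d)"
      using that(2) by (intro rep_p_biword) auto
    then have "bw_length (Biword ([1..<Suc k], d)) = k"
      unfolding bw_length_def by (simp del: upt_Suc)
    then show "1 \<le> bw_length (Biword ([1..<Suc k], d))" using that(1) by simp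
  qed
  then have "(\<Sum>k = 1..n. \<Sum>d\<in>{d. length d = k \<and> 0 \<notin> set d \<and> sum_list d = n}.
      basis_elt (Biword ([1..<Suc k], d))) \<in> S_plus"
    by (intro fs.subspace_sum[OF subspace_S_plus])
  with assms show ?thesis unfolding p_elt_def by simp
qed

lemma dendriform_span_closed:
  "X \<subseteq> dendriform_span X"
  "fs.subspace (dendriform_span X)"
  "\<lbrakk>x \<in> dendriform_span X; y \<in> dendriform_span X\<rbrakk> \<Longrightarrow> S_lt x y \<in> dendriform_span X"
  "\<lbrakk>x \<in> dendriform_span X; y \<in> dendriform_span X\<rbrakk> \<Longrightarrow> S_gt x y \<in> dendriform_span X"
  unfolding dendriform_span_def by (auto intro!: fs.subspace_Inter)

lemma dendriform_span_least:
  assumes "X \<subseteq> V" "fs.subspace V"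
    and "\<And>x y. \<lbrakk>x \<in> V; y \<in> V\<rbrakk> \<Longrightarrow> S_lt x y \<in> V \<and> S_gt x y \<in> V"
  shows "dendriform_span X \<subseteq> V"
  using assms unfolding dendriform_span_def by blast

lemma Descd_plus_subset: "Descd_plus \<subseteq> S_plus"
  unfolding Descd_plus_def
  by (rule dendriform_span_least) (auto simp: subspace_S_plus S_plus_closed p_elt_in_S_plus)

lemma lookup_empty_S_plus: "x \<in> S_plus \<Longrightarrow> Poly_Mapping.lookup x empty_biword = 0"
  unfolding S_plus_def
  by (induction rule: fs.span_induct_alt)
     (auto simp: lookup_add lookup_single when_def bw_length_eq_0_iff[symmetric])

lemma Descd_eq: "Descd = {qscale c unit_elt + x |c x. x \<in> Descd_plus}"
proof
  let ?W = "{qscale c unit_elt + x |c x. x \<in> Descd_plus}"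
  note cl = dendriform_span_closed[where X = "p_elt ` {1..}", folded Descd_plus_def]
  have W: "qscale c unit_elt + x \<in> ?W" if "x \<in> Descd_plus" for c x
    using that by blast
  have sub: "Descd_plus \<subseteq> ?W"
  proof
    fix x assume "x \<in> Descd_plus"
    from W[OF this, of 0] show "x \<in> ?W" by simp
  qed
  show "Descd \<subseteq> ?W"
    unfolding Descd_def
  proof (rule dendriform_span_least)
    show "range p_elt \<subseteq> ?W"
    proof safe
      fix n
      show "\<exists>c x. p_elt n = qscale c unit_elt + x \<and> x \<in> Descd_plus"
      proof (cases "n = 0")
        case True
        then have "p_elt n = qscale 1 unit_elt + 0" by (simp add: p_elt_def)
        then show ?thesis using fs.subspace_0[OF cl(2)] by blast
      next
        case False
        then have "p_elt n \<in> Descd_plus" using cl(1) by auto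
        then show ?thesis using sub by auto
      qed
    qed
  next
    show "fs.subspace ?W"
    proof (rule fs.subspaceI)
      show "0 \<in> ?W" by (rule subsetD[OF sub fs.subspace_0[OF cl(2)]])
    next
      fix a b assume "a \<in> ?W" "b \<in> ?W"
      then obtain c x d y where "a = qscale c unit_elt + x" "b = qscale d unit_elt + y"
        "x \<in> Descd_plus" "y \<in> Descd_plus" by blast
      moreover from this have "a + b = qscale (c + d) unit_elt + (x + y)"
        by (simp add: fs.scale_left_distrib)
      ultimately show "a + b \<in> ?W" using fs.subspace_add[OF cl(2)] by blast
    next
      fix e a assume "a \<in> ?W"
      then obtain c x where "a = qscale c unit_elt + x" "x \<in> Descd_plus" by blast
      moreover from this have "qscale e a = qscale (e * c) unit_elt + qscale e x"
        by (simp add: fs.scale_right_distrib)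
      ultimately show "qscale e a \<in> ?W" using fs.subspace_scale[OF cl(2)] by blast
    qed
  next
    fix a b assume "a \<in> ?W" "b \<in> ?W"
    then obtain c x d y where ab: "a = qscale c unit_elt + x" "b = qscale d unit_elt + y"
      and xy: "x \<in> Descd_plus" "y \<in> Descd_plus" by blast
    then have S: "x \<in> S_plus" "y \<in> S_plus" using Descd_plus_subset by auto
    have "S_lt a b = qscale d x + S_lt x y" "S_gt a b = qscale c y + S_gt x y"
      using S_unit[OF S(1)] S_unit[OF S(2)]
      by (simp_all add: ab S_lt_def S_gt_def bilinear_ext_simps)
    moreover have "qscale d x + S_lt x y \<in> Descd_plus" "qscale c y + S_gt x y \<in> Descd_plus"
      using xy cl by (auto intro!: fs.subspace_add fs.subspace_scale)
    ultimately show "S_lt a b \<in> ?W \<and> S_gt a b \<in> ?W" using sub by auto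
  qed
next
  note cl = dendriform_span_closed[where X = "range p_elt", folded Descd_def]
  have "Descd_plus \<subseteq> Descd"
    unfolding Descd_plus_def by (rule dendriform_span_least) (use cl in auto)
  moreover have "unit_elt \<in> Descd"
    using cl(1) by (force simp: p_elt_def)
  ultimately show "{qscale c unit_elt + x |c x. x \<in> Descd_plus} \<subseteq> Descd"
    using cl(2) by (auto intro!: fs.subspace_add fs.subspace_scale)
qed

lemma Descd_plus_eq: "Descd_plus = Descd \<inter> S_plus"
proof -
  have "qscale c unit_elt + x \<in> Descd_plus"
    if "x \<in> Descd_plus" "qscale c unit_elt + x \<in> S_plus" for c x
  proof -
    have "Poly_Mapping.lookup (qscale c unit_elt + x) empty_biword = c"
      using that(1) Descd_plus_subset lookup_empty_S_plus
      by (auto simp: lookup_add unit_elt_def)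
    then have "c = 0" using lookup_empty_S_plus[OF that(2)] by simp
    then show ?thesis using that(1) by simp
  qed
  moreover have "Descd_plus \<subseteq> Descd"
  proof
    fix x assume "x \<in> Descd_plus"
    moreover have "x = qscale 0 unit_elt + x" by simp
    ultimately show "x \<in> Descd" unfolding Descd_eq by blast
  qed
  ultimately show ?thesis
    using Descd_plus_subset by (auto simp: Descd_eq)
qed

end

theory Submission
  imports Defs "HOL-Library.Tree" "HOL-Library.Product_Plus"
begin

text \<open>
  In any dendriform algebra a family \<open>b\<close> of elements gives monomials indexed by the nonempty
  binary trees with labelled nodes: the node \<open>\<langle>l, i, r\<rangle>\<close> stands for \<open>(m\<^sub>l \<succ> b\<^sub>i) \<prec> m\<^sub>r\<close>, where an
  empty subtree is left out. The axioms rewrite a product of two monomials as a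
  combination of monomials (\<open>monomial_span_closed\<close>), so the monomials span the
  subalgebra generated by \<open>b\<close>. If they are linearly independent, that subalgebra is free
  (\<open>free_dendriform_onI\<close>).

  Graded permutations are treated through their coefficient functions. A half-shuffle of \<open>u\<close>
  and \<open>v\<close> is a biword whose letters up to the length of \<open>u\<close> form \<open>u\<close> and whose other letters,
  shifted down, form \<open>v\<close>. Hence the coefficient of \<open>w\<close> in \<open>x \<prec> y\<close> or \<open>x \<succ> y\<close> is a sum, over a
  range of thresholds \<open>k\<close>, of the product of the coefficients of \<open>x\<close> at the small letters of \<open>w\<close>
  and of \<open>y\<close> at the large ones; the two products differ in the side of the threshold on
  which the first letter of \<open>w\<close> lies (\<open>lookup_S_products\<close>). From this formula
  the dendriform axioms follow by exchanging sums, and by induction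
  the tree monomial of \<open>T\<close> in the \<open>\<pi>\<^sub>n\<close> is the sum, without multiplicities, of the biwords whose
  binary search tree is \<open>T\<close> (\<open>lookup_monomial\<close>). Such monomials have disjoint supports and are
  therefore independent. Since \<open>p\<^sub>n = \<pi>\<^sub>n + \<Sum>\<^sub>i \<pi>\<^sub>i \<prec> p\<^bsub>n-i\<^esub>\<close>, the \<open>\<pi>\<^sub>n\<close> and the \<open>p\<^sub>n\<close> generate the same
  subalgebra, which is thus free on the \<open>\<pi>\<^sub>n\<close>.

  It follows that the coefficient of \<open>w\<close> in an element \<open>x\<close> of this subalgebra depends on the
  search tree of \<open>w\<close> only. Let \<open>x\<close> be primitive. If the first letter of \<open>w\<close> is \<open>h > 1\<close>, we may
  move all letters \<open>\<ge> h\<close> of \<open>w\<close> before all smaller ones without changing the tree. Cutting this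
  rearranged word between the two groups gives a term of \<open>\<Delta>\<^sub>\<succ>\<close> which, among all other words in
  \<open>x\<close>, can only come from words with first letter strictly between \<open>1\<close> and \<open>h\<close>. Induction on \<open>h\<close>
  shows that all these coefficients vanish (\<open>primitive_coefficient_first_gt\<close>). If \<open>w\<close> has
  length at least \<open>2\<close> and starts with \<open>1\<close>, cutting after the first letter gives a term of
  \<open>\<Delta>\<^sub>\<prec>\<close> that comes from \<open>w\<close> alone (\<open>primitive_coefficient_first_one\<close>). Only words of length
  one are left, that is, the \<open>\<pi>\<^sub>n\<close>.
\<close>

section \<open>Tree monomials and free dendriform algebras\<close>

abbreviation trees_over :: "'i set \<Rightarrow> 'i tree set" where
  "trees_over I \<equiv> {T. T \<noteq> Leaf \<and> set_tree T \<subseteq> I}"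

context dendriform_algebra
begin

text \<open>A dendriform algebra has no unit, so empty subtrees are skipped case by case; the value
  at \<open>Leaf\<close> is a dummy.\<close>
primrec tree_monomial :: "('i \<Rightarrow> 'a) \<Rightarrow> 'i tree \<Rightarrow> 'a" where
  "tree_monomial b Leaf = 0"
| "tree_monomial b (Node l i r) =
     (let c = if l = Leaf then b i else tree_monomial b l \<succ> b i
      in if r = Leaf then c else c \<prec> tree_monomial b r)"

lemma monomial_closed:
  assumes "\<forall>i\<in>I. b i \<in> A" "T \<in> trees_over I"
  shows "tree_monomial b T \<in> A"
  using assms(2)
proof (induction T)
  case (Node l i r)
  have "(if l = Leaf then b i else tree_monomial b l \<succ> b i) \<in> A"
    using Node assms(1) by (auto intro: gt_closed)
  then show ?case
    using Node by (auto simp: Let_def intro: lt_closed)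
qed simp

lemma span_subset_A: "X \<subseteq> A \<Longrightarrow> span X \<subseteq> A"
  by (rule span_minimal[OF _ subspace_A])

lemma linear_span_into:
  assumes add: "\<And>u v. \<lbrakk>u \<in> A; v \<in> A\<rbrakk> \<Longrightarrow> f (u + v) = f u + f v"
    and hom: "\<And>c u. u \<in> A \<Longrightarrow> f (scale c u) = scale c (f u)"
    and X: "X \<subseteq> A" and W: "subspace W" "\<And>x. x \<in> X \<Longrightarrow> f x \<in> W"
    and z: "z \<in> span X"
  shows "f z \<in> W"
proof -
  have "z \<in> A \<and> f z \<in> W"
    using z
  proof (induction rule: span_induct_alt)
    case base
    have "f (scale 0 0) = scale 0 (f 0)"
      by (rule hom) (rule subspace_0[OF subspace_A])
    then show ?case using subspace_0[OF W(1)] subspace_0[OF subspace_A] by simp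
  next
    case (step c x z)
    have "x \<in> A" using step.hyps(1) X by (rule subsetD[rotated])
    moreover from this have "f (scale c x + z) = scale c (f x) + f z"
      using step.IH by (simp add: add hom subspace_scale[OF subspace_A])
    ultimately show ?case
      using step W by (simp add: subspace_add subspace_scale subspace_A)
  qed
  then show ?thesis ..
qed

lemma span_into:
  assumes "X \<subseteq> A" "y \<in> A" "subspace W" "z \<in> span X"
  shows lt_span_right: "(\<And>x. x \<in> X \<Longrightarrow> y \<prec> x \<in> W) \<Longrightarrow> y \<prec> z \<in> W"
    and lt_span_left: "(\<And>x. x \<in> X \<Longrightarrow> x \<prec> y \<in> W) \<Longrightarrow> z \<prec> y \<in> W"
    and gt_span_right: "(\<And>x. x \<in> X \<Longrightarrow> y \<succ> x \<in> W) \<Longrightarrow> y \<succ> z \<in> W"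
    and gt_span_left: "(\<And>x. x \<in> X \<Longrightarrow> x \<succ> y \<in> W) \<Longrightarrow> z \<succ> y \<in> W"
  using assms(2)
  by (rule_tac linear_span_into[OF _ _ assms(1,3) _ assms(4)];
      simp add: lt_add_left lt_add_right gt_add_left gt_add_right
        lt_scale_left lt_scale_right gt_scale_left gt_scale_right)+

text \<open>\<open>m\<^sub>S \<prec> m\<^sub>T\<close> pushes \<open>m\<^sub>T\<close> into the right subtree of \<open>S\<close> by \<open>lt_lt\<close>, and \<open>m\<^sub>S \<succ> m\<^sub>T\<close> pushes
  \<open>m\<^sub>S\<close> into the left subtree of \<open>T\<close> by \<open>gt_lt\<close> and \<open>gt_gt\<close>. What appears there is the sum of both
  products of smaller trees, so the two claims go through one induction on the total size;
  grafting the resulting combination back on the remaining tree is linear.\<close>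
lemma monomial_products:
  assumes b: "\<forall>i\<in>I. b i \<in> A" and "S \<in> trees_over I" "T \<in> trees_over I"
  shows "tree_monomial b S \<prec> tree_monomial b T \<in> span (tree_monomial b ` trees_over I) \<and>
         tree_monomial b S \<succ> tree_monomial b T \<in> span (tree_monomial b ` trees_over I)"
  using assms(2,3)
proof (induction "size S + size T" arbitrary: S T rule: less_induct)
  case less
  let ?m = "tree_monomial b"
  let ?X = "?m ` trees_over I"
  have XA: "?X \<subseteq> A"
    using monomial_closed[OF b] by blast
  have mA: "?m U \<in> A" if "U \<in> trees_over I" for U
    using that XA by blast
  have star: "?m U \<prec> ?m V + ?m U \<succ> ?m V \<in> span ?X"
    if "U \<in> trees_over I" "V \<in> trees_over I" "size U + size V < size S + size T" for U V
    using less.hyps[OF that(3,1,2)] by (intro span_add) auto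
  have "?m S \<prec> ?m T \<in> span ?X"
  proof (cases S)
    case Leaf
    then show ?thesis using less.prems by simp
  next
    case (Node l i r)
    define c where "c = (if l = Leaf then b i else ?m l \<succ> b i)"
    have c: "c \<in> A" and graft: "\<And>U. U \<in> trees_over I \<Longrightarrow> c \<prec> ?m U \<in> ?X"
    proof -
      show "c \<in> A" using Node less.prems b mA by (auto simp: c_def intro!: gt_closed)
      show "c \<prec> ?m U \<in> ?X" if "U \<in> trees_over I" for U
        using that Node less.prems
        by (intro image_eqI[of _ _ "Node l i U"]) (auto simp: c_def Let_def)
    qed
    show ?thesis
    proof (cases "r = Leaf")
      case True
      then have "?m S \<prec> ?m T = c \<prec> ?m T" by (simp add: Node c_def)
      then show ?thesis using graft[OF less.prems(2)] span_base by simp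
    next
      case False
      then have r: "r \<in> trees_over I" using Node less.prems by auto
      have "?m S \<prec> ?m T = (c \<prec> ?m r) \<prec> ?m T" using False by (simp add: Node c_def)
      also have "\<dots> = c \<prec> (?m r \<prec> ?m T + ?m r \<succ> ?m T)"
        using c mA[OF r] mA[OF less.prems(2)] by (rule lt_lt)
      also have "\<dots> \<in> span ?X"
        by (rule lt_span_right[OF XA c subspace_span])
           (use graft span_base star[OF r less.prems(2)] Node in auto)
      finally show ?thesis .
    qed
  qed
  moreover have "?m S \<succ> ?m T \<in> span ?X"
  proof (cases T)
    case Leaf
    then show ?thesis using less.prems by simp
  next
    case (Node l i r)
    have i: "b i \<in> A" using Node less.prems b by auto
    define rgraft where "rgraft c = (if r = Leaf then c else c \<prec> ?m r)" for c
    have graft: "rgraft (?m U \<succ> b i) \<in> span ?X" if "U \<in> trees_over I" for U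
      using that Node less.prems
      by (intro span_base image_eqI[of _ _ "Node U i r"]) (auto simp: rgraft_def Let_def)
    have S: "?m S \<in> A" by (rule mA[OF less.prems(1)])
    have r: "r \<noteq> Leaf \<Longrightarrow> ?m r \<in> A" using Node less.prems by (intro mA) auto
    have out: "?m S \<succ> rgraft c = rgraft (?m S \<succ> c)" if "c \<in> A" for c
      using gt_lt[OF S that] r by (simp add: rgraft_def)
    show ?thesis
    proof (cases "l = Leaf")
      case True
      then have "?m T = rgraft (b i)" by (simp add: Node rgraft_def)
      then have "?m S \<succ> ?m T = rgraft (?m S \<succ> b i)"
        using out[OF i] by simp
      then show ?thesis using graft[OF less.prems(1)] by simp
    next
      case False
      then have l: "l \<in> trees_over I" using Node less.prems by auto
      have "?m T = rgraft (?m l \<succ> b i)"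
        using False by (simp add: Node rgraft_def)
      then have "?m S \<succ> ?m T = ?m S \<succ> rgraft (?m l \<succ> b i)" by simp
      also have "\<dots> = rgraft ((?m S \<prec> ?m l + ?m S \<succ> ?m l) \<succ> b i)"
        using out gt_closed gt_gt S mA[OF l] i by simp
      also have "\<dots> \<in> span ?X"
      proof (cases "r = Leaf")
        case True
        then show ?thesis
          using gt_span_left[OF XA i subspace_span star[OF less.prems(1) l]] graft
            Node by (auto simp: rgraft_def)
      next
        case False
        let ?Y = "(\<lambda>x. x \<succ> b i) ` ?X"
        have Y: "?Y \<subseteq> A" using XA i gt_closed by blast
        have "(?m S \<prec> ?m l + ?m S \<succ> ?m l) \<succ> b i \<in> span ?Y"
          by (rule gt_span_left[OF XA i subspace_span])
             (use span_base star[OF less.prems(1) l] Node in auto)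
        then have "(?m S \<prec> ?m l + ?m S \<succ> ?m l) \<succ> b i \<prec> ?m r \<in> span ?X"
          by (rule lt_span_left[OF Y r[OF False] subspace_span])
             (use graft False in \<open>auto simp: rgraft_def\<close>)
        then show ?thesis using False by (simp add: rgraft_def)
      qed
      finally show ?thesis .
    qed
  qed
  ultimately show ?case by blast
qed

lemma monomial_span_closed:
  assumes b: "\<forall>i\<in>I. b i \<in> A"
    and x: "x \<in> span (tree_monomial b ` trees_over I)"
    and y: "y \<in> span (tree_monomial b ` trees_over I)"
  shows "x \<prec> y \<in> span (tree_monomial b ` trees_over I)"
    and "x \<succ> y \<in> span (tree_monomial b ` trees_over I)"
proof -
  let ?X = "tree_monomial b ` trees_over I"
  have XA: "?X \<subseteq> A"
    using monomial_closed[OF b] by blast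
  then have yA: "y \<in> A" using span_subset_A y by blast
  have "tree_monomial b S \<prec> y \<in> span ?X \<and> tree_monomial b S \<succ> y \<in> span ?X"
    if S: "S \<in> trees_over I" for S
    using lt_span_right[OF XA monomial_closed[OF b S] subspace_span y]
      gt_span_right[OF XA monomial_closed[OF b S] subspace_span y]
      monomial_products[OF b S] by blast
  then show "x \<prec> y \<in> span ?X" "x \<succ> y \<in> span ?X"
    using lt_span_left[OF XA yA subspace_span x] gt_span_left[OF XA yA subspace_span x]
    by blast+
qed

end

context dendriform_hom
begin

lemma hom_monomial:
  assumes "\<forall>i\<in>I. x i \<in> A" "T \<in> trees_over I"
  shows "f (dom.tree_monomial x T) = cod.tree_monomial (\<lambda>i. f (x i)) T"
  using assms(2)
proof (induction T)
  case (Node l i r)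
  have i: "x i \<in> A" and l: "l \<noteq> Leaf \<Longrightarrow> dom.tree_monomial x l \<in> A"
    and r: "r \<noteq> Leaf \<Longrightarrow> dom.tree_monomial x r \<in> A"
    using Node.prems assms(1) by (auto intro: dom.monomial_closed[OF assms(1)])
  then have "l \<noteq> Leaf \<Longrightarrow> gtA (dom.tree_monomial x l) (x i) \<in> A"
    by (simp add: dom.gt_closed)
  then show ?case
    using Node i l r by (auto simp: Let_def hom_lt hom_gt)
qed simp

end

text \<open>A linear map is a homomorphism exactly if its graph is a subalgebra of the product; this
  is how the product algebra enters the universal property below.\<close>
lemma dendriform_prod:
  assumes "dendriform_algebra sA A ltA gtA" "dendriform_algebra sB B ltB gtB"
  shows "dendriform_algebra (\<lambda>c (x, y). (sA c x, sB c y)) (A \<times> B)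
    (\<lambda>(x, y) (x', y'). (ltA x x', ltB y y')) (\<lambda>(x, y) (x', y'). (gtA x x', gtB y y'))"
proof -
  interpret a: dendriform_algebra sA A ltA gtA by fact
  interpret b: dendriform_algebra sB B ltB gtB by fact
  interpret v: vector_space "\<lambda>c (x, y). (sA c x, sB c y)"
    by unfold_locales
      (auto simp: a.scale_right_distrib a.scale_left_distrib b.scale_right_distrib b.scale_left_distrib)
  show ?thesis
  proof (unfold_locales, goal_cases)
    case 1
    show ?case
      by (rule v.subspaceI)
        (auto simp: zero_prod_def a.subspace_0[OF a.subspace_A] b.subspace_0[OF b.subspace_A]
         a.subspace_add[OF a.subspace_A] b.subspace_add[OF b.subspace_A]
         a.subspace_scale[OF a.subspace_A] b.subspace_scale[OF b.subspace_A])
  qed (auto simp: a.lt_closed b.lt_closed a.gt_closed b.gt_closed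
      a.lt_add_left a.lt_add_right a.gt_add_left a.gt_add_right
      b.lt_add_left b.lt_add_right b.gt_add_left b.gt_add_right
      a.lt_scale_left a.lt_scale_right a.gt_scale_left a.gt_scale_right
      b.lt_scale_left b.lt_scale_right b.gt_scale_left b.gt_scale_right
      a.lt_lt b.lt_lt a.gt_lt b.gt_lt a.gt_gt[symmetric] b.gt_gt[symmetric])
qed

text \<open>Independence gives a linear map \<open>f\<close> that sends each monomial in the \<open>x\<^sub>i\<close> to the same
  monomial in the \<open>b\<^sub>i\<close>. Its graph is the span of the monomials in the pairs \<open>(x\<^sub>i, b\<^sub>i)\<close>, which
  is closed under the products of \<open>A \<times> B\<close>. So \<open>f\<close> is a homomorphism.\<close>
theorem (in dendriform_algebra) free_dendriform_onI:
  fixes x :: "'i \<Rightarrow> 'a"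
  assumes x: "\<forall>i\<in>I. x i \<in> A"
    and inj: "inj_on (tree_monomial x) (trees_over I)"
    and indep: "independent (tree_monomial x ` trees_over I)"
    and gen: "span (tree_monomial x ` trees_over I) = A"
  shows "free_dendriform_on TYPE('b::ab_group_add) scale A (\<prec>) (\<succ>) I x"
  unfolding free_dendriform_on_def
proof (intro conjI allI impI)
  show "dendriform_algebra scale A (\<prec>) (\<succ>)" by (rule dendriform_algebra_axioms)
  show "\<forall>i\<in>I. x i \<in> A" by fact
next
  fix sB and B :: "'b set" and ltB gtB b
  assume "dendriform_algebra sB B ltB gtB \<and> (\<forall>i\<in>I. b i \<in> B)"
  then have db: "dendriform_algebra sB B ltB gtB" and b: "\<forall>i\<in>I. b i \<in> B" by auto
  interpret b: dendriform_algebra sB B ltB gtB by fact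
  let ?m = "tree_monomial x" and ?X = "tree_monomial x ` trees_over I"
  define sP where "sP = (\<lambda>c (u, v). (scale c u, sB c v))"
  define ltP where "ltP = (\<lambda>(u, v) (u', v'). (u \<prec> u', ltB v v'))"
  define gtP where "gtP = (\<lambda>(u, v) (u', v'). (u \<succ> u', gtB v v'))"
  interpret p: dendriform_algebra sP "A \<times> B" ltP gtP
    unfolding sP_def ltP_def gtP_def
    by (rule dendriform_prod) (use db dendriform_algebra_axioms in auto)
  interpret vp: vector_space_pair scale sB by unfold_locales
  have P: "ltP (u, v) (u', v') = (u \<prec> u', ltB v v')" "gtP (u, v) (u', v') = (u \<succ> u', gtB v v')"
    for u v u' v'
    by (simp_all add: ltP_def gtP_def)
  let ?y = "\<lambda>i. (x i, b i)"
  let ?P = "p.tree_monomial ?y ` trees_over I"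
  have y: "\<forall>i\<in>I. ?y i \<in> A \<times> B" using x b by auto
  have pm: "p.tree_monomial ?y T = (?m T, b.tree_monomial b T)" for T
    by (induction T) (auto simp: zero_prod_def Let_def P)
  obtain f where f: "Vector_Spaces.linear scale sB f"
    "\<And>T. T \<in> trees_over I \<Longrightarrow> f (?m T) = b.tree_monomial b T"
  proof -
    obtain f where "Vector_Spaces.linear scale sB f"
      "\<forall>u\<in>?X. f u = b.tree_monomial b (inv_into (trees_over I) ?m u)"
      using vp.linear_independent_extend[OF indep,
          of "\<lambda>u. b.tree_monomial b (inv_into (trees_over I) ?m u)"] by auto
    then show ?thesis
      using that inv_into_f_f[OF inj] by simp
  qed
  have graph: "u \<in> A \<and> f u = v" if "(u, v) \<in> p.span ?P" for u v
  proof -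
    have "fst w \<in> A \<and> f (fst w) = snd w" if "w \<in> p.span ?P" for w
      using that
    proof (induction rule: p.span_induct_alt)
      case base
      then show ?case using subspace_0[OF subspace_A] vp.linear_0[OF f(1)] by simp
    next
      case (step c w z)
      then obtain T where T: "T \<in> trees_over I" "w = p.tree_monomial ?y T" by blast
      then show ?case
        using step.IH f(2)[OF T(1)] monomial_closed[OF x T(1)]
        by (auto simp: pm sP_def subspace_add[OF subspace_A] subspace_scale[OF subspace_A]
            vp.linear_add[OF f(1)] vp.linear_scale[OF f(1)] split: prod.splits)
    qed
    from this[OF that] show ?thesis by simp
  qed
  have in_graph: "(u, f u) \<in> p.span ?P" if "u \<in> A" for u
  proof -
    have "u \<in> span ?X" using that gen by simp
    then show ?thesis
    proof (induction rule: span_induct_alt)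
      case base
      then show ?case
        using p.span_zero vp.linear_0[OF f(1)] by (simp add: zero_prod_def)
    next
      case (step c w z)
      then obtain T where T: "T \<in> trees_over I" "w = ?m T" by blast
      then have "(w, f w) \<in> p.span ?P"
        using f(2)[OF T(1)] by (intro p.span_base) (auto simp: pm image_iff)
      then have "sP c (w, f w) + (z, f z) \<in> p.span ?P"
        using step.IH by (intro p.span_add p.span_scale)
      then show ?case
        by (simp add: sP_def vp.linear_add[OF f(1)] vp.linear_scale[OF f(1)])
    qed
  qed
  have prods: "f (u \<prec> v) = ltB (f u) (f v)" "f (u \<succ> v) = gtB (f u) (f v)"
    if "u \<in> A" "v \<in> A" for u v
    using p.monomial_span_closed[OF y in_graph[OF that(1)] in_graph[OF that(2)]] graph
    by (auto simp: P)
  have fB: "f u \<in> B" if "u \<in> A" for u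
    using in_graph[OF that] p.span_subset_A[of ?P] p.monomial_closed[OF y] by blast
  have hom: "dendriform_hom scale A (\<prec>) (\<succ>) sB B ltB gtB f"
    by unfold_locales
      (auto simp: prods fB vp.linear_add[OF f(1)] vp.linear_scale[OF f(1)])
  have fx: "f (x i) = b i" if "i \<in> I" for i
    using f(2)[of "Node Leaf i Leaf"] that by simp
  have "g a = f a" if g: "dendriform_hom scale A (\<prec>) (\<succ>) sB B ltB gtB g"
    "\<forall>i\<in>I. g (x i) = b i" and a: "a \<in> A" for g a
  proof -
    interpret g: dendriform_hom scale A "(\<prec>)" "(\<succ>)" sB B ltB gtB g by fact
    have cong: "b.tree_monomial (\<lambda>i. g (x i)) T = b.tree_monomial b T" if "T \<in> trees_over I" for T
      using that g(2) by (induction T) (auto simp: Let_def)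
    have "a \<in> span ?X" using a gen by simp
    then have "a \<in> A \<and> g a = f a"
    proof (induction rule: span_induct_alt)
      case base
      have "g (scale 0 0) = sB 0 (g 0)"
        by (rule g.hom_scale) (rule subspace_0[OF subspace_A])
      then show ?case using vp.linear_0[OF f(1)] subspace_0[OF subspace_A] by simp
    next
      case (step c w z)
      then obtain T where T: "T \<in> trees_over I" "w = ?m T" by blast
      have "w \<in> A" "scale c w \<in> A"
        using monomial_closed[OF x T(1)] T(2) subspace_scale[OF subspace_A] by auto
      moreover have "g w = f w"
        using f(2)[OF T(1)] g.hom_monomial[OF x T(1)] cong[OF T(1)] T(2) by simp
      ultimately show ?case
        using step.IH
        by (simp add: g.hom_add g.hom_scale vp.linear_add[OF f(1)] vp.linear_scale[OF f(1)]
            subspace_add[OF subspace_A])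
    qed
    then show ?thesis ..
  qed
  with hom fx show "\<exists>f. dendriform_hom scale A (\<prec>) (\<succ>) sB B ltB gtB f \<and> (\<forall>i\<in>I. f (x i) = b i) \<and>
      (\<forall>g. dendriform_hom scale A (\<prec>) (\<succ>) sB B ltB gtB g \<and> (\<forall>i\<in>I. g (x i) = b i) \<longrightarrow>
        (\<forall>a\<in>A. g a = f a))"
    by blast
qed

section \<open>Biwords as lists of columns\<close>

definition entries :: "biword \<Rightarrow> (nat \<times> nat) list" where
  "entries w = zip (top_row w) (bottom_row w)"

definition bw_of :: "(nat \<times> nat) list \<Rightarrow> biword" where
  "bw_of es = Biword (map fst es, map snd es)"

lemma rows_eq: "top_row w = map fst (entries w)" "bottom_row w = map snd (entries w)"
  using rep_biword_cases(3)[of w] by (simp_all add: entries_def bw_length_def)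

lemma length_entries [simp]: "length (entries w) = bw_length w"
  by (metis bw_length_def length_map rows_eq(1))

lemma distinct_entries: "distinct (map fst (entries w))"
  using rep_biword_cases(1)[of w] by (simp add: rows_eq)

lemma set_entries: "fst ` set (entries w) = {1..bw_length w}" "0 \<notin> snd ` set (entries w)"
  using rep_biword_cases(2,4)[of w] by (simp_all add: rows_eq)

lemma entries_inject: "entries w = entries w' \<longleftrightarrow> w = w'"
  by (metis prod.collapse rep_biword_inject rows_eq)

lemma entries_bw_of:
  assumes "distinct (map fst es)" "fst ` set es = {1..m}" "0 \<notin> snd ` set es"
  shows "entries (bw_of es) = es"
proof -
  have "length es = m"
    using assms(1,2) distinct_card[OF assms(1)] by simp
  then have "rep_biword (bw_of es) = (map fst es, map snd es)"
    unfolding bw_of_def using assms by (intro Biword_inverse) simp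
  then show ?thesis by (simp add: entries_def zip_map_fst_snd)
qed

definition low :: "nat \<Rightarrow> biword \<Rightarrow> biword" where
  "low k w = bw_of (filter (\<lambda>e. fst e \<le> k) (entries w))"

definition high :: "nat \<Rightarrow> biword \<Rightarrow> biword" where
  "high k w = bw_of (map (apfst (\<lambda>s. s - k)) (filter (\<lambda>e. k < fst e) (entries w)))"

lemma entries_low: "entries (low k w) = filter (\<lambda>e. fst e \<le> k) (entries w)"
  unfolding low_def
proof (rule entries_bw_of)
  show "distinct (map fst (filter (\<lambda>e. fst e \<le> k) (entries w)))"
    by (rule distinct_map_filter) (rule distinct_entries)
  have "fst ` set (filter (\<lambda>e. fst e \<le> k) (entries w)) = fst ` set (entries w) \<inter> {..k}"
    by auto
  then show "fst ` set (filter (\<lambda>e. fst e \<le> k) (entries w)) = {1..min k (bw_length w)}"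
    by (auto simp: set_entries)
qed (use set_entries(2)[of w] in auto)

lemma entries_high:
  "entries (high k w) = map (apfst (\<lambda>s. s - k)) (filter (\<lambda>e. k < fst e) (entries w))"
  unfolding high_def
proof (rule entries_bw_of)
  let ?F = "filter (\<lambda>e. k < fst e) (entries w)"
  have comp: "map fst (map (apfst (\<lambda>s. s - k)) ?F) = map (\<lambda>s. s - k) (map fst ?F)"
    by simp
  have set: "fst ` set ?F = fst ` set (entries w) \<inter> {k<..}"
    by auto
  have "distinct (map fst ?F)"
    by (rule distinct_map_filter) (rule distinct_entries)
  then show "distinct (map fst (map (apfst (\<lambda>s. s - k)) ?F))"
    unfolding comp by (subst distinct_map) (auto simp: inj_on_def)
  have "fst ` set (map (apfst (\<lambda>s. s - k)) ?F) = (\<lambda>s. s - k) ` ({1..bw_length w} \<inter> {k<..})"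
    by (simp only: set[unfolded set_entries, symmetric] image_image set_map fst_apfst)
  also have "\<dots> = {1..bw_length w - k}"
  proof -
    have "s \<in> (\<lambda>s. s - k) ` ({1..bw_length w} \<inter> {k<..})" if "s \<in> {1..bw_length w - k}" for s
      using that by (intro image_eqI[of _ _ "s + k"]) auto
    then show ?thesis by auto
  qed
  finally show "fst ` set (map (apfst (\<lambda>s. s - k)) ?F) = {1..bw_length w - k}" .
  have "snd ` set (map (apfst (\<lambda>s. s - k)) ?F) \<subseteq> snd ` set (entries w)"
    by force
  then show "0 \<notin> snd ` set (map (apfst (\<lambda>s. s - k)) ?F)"
    using set_entries(2)[of w] by blast
qed

lemma bw_length_low: "bw_length (low k w) = min k (bw_length w)"
proof -
  have "fst ` set (entries (low k w)) = fst ` set (entries w) \<inter> {..k}"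
    by (auto simp: entries_low)
  then have "{1..bw_length (low k w)} = {1..min k (bw_length w)}"
    by (auto simp: set_entries)
  then show ?thesis by (metis card_atLeastAtMost diff_Suc_1)
qed

lemma bw_length_high: "bw_length (high k w) = bw_length w - k"
proof -
  have "length (filter (\<lambda>e. fst e \<le> k) (entries w)) + bw_length (high k w) = bw_length w"
    using sum_length_filter_compl[of "\<lambda>e. fst e \<le> k" "entries w"]
    by (simp flip: length_entries add: entries_high not_le)
  then show ?thesis
    using bw_length_low[of k w] by (simp flip: length_entries add: entries_low)
qed

lemma low_low: "k \<le> m \<Longrightarrow> low k (low m w) = low k w"
  by (subst entries_inject[symmetric]) (auto simp: entries_low intro!: filter_cong)

lemma high_low: "high k (low (k + j) w) = low j (high k w)"
  by (subst entries_inject[symmetric])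
     (auto simp: entries_low entries_high filter_map o_def intro!: arg_cong[of _ _ "map _"] filter_cong)

lemma high_high: "high j (high k w) = high (k + j) w"
  by (subst entries_inject[symmetric])
     (auto simp: entries_high filter_map o_def apfst_def map_prod_def split_beta intro!: map_cong filter_cong)

definition first_letter :: "biword \<Rightarrow> nat" where
  "first_letter w = fst (hd (entries w))"

definition first_label :: "biword \<Rightarrow> nat" where
  "first_label w = snd (hd (entries w))"

lemma entries_eq_Nil: "entries w = [] \<longleftrightarrow> bw_length w = 0"
  by (metis length_0_conv length_entries)

lemma first_letter_bounds:
  assumes "bw_length w > 0"
  shows "1 \<le> first_letter w" "first_letter w \<le> bw_length w"
proof -
  have "first_letter w \<in> fst ` set (entries w)"
    using assms by (simp add: first_letter_def entries_eq_Nil)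
  then show "1 \<le> first_letter w" "first_letter w \<le> bw_length w"
    by (simp_all add: set_entries)
qed

lemma hd_filter: "xs \<noteq> [] \<Longrightarrow> P (hd xs) \<Longrightarrow> hd (filter P xs) = hd xs"
  by (cases xs) auto

lemma first_low:
  assumes "bw_length w > 0" "first_letter w \<le> k"
  shows "first_letter (low k w) = first_letter w" "first_label (low k w) = first_label w"
  using assms by (simp_all add: first_letter_def first_label_def entries_low hd_filter entries_eq_Nil)

lemma first_high:
  assumes "bw_length w > 0" "k < first_letter w"
  shows "first_letter (high k w) = first_letter w - k" "first_label (high k w) = first_label w"
proof -
  have "hd (filter (\<lambda>e. k < fst e) (entries w)) = hd (entries w)"
    using assms by (simp add: first_letter_def hd_filter entries_eq_Nil)
  moreover have "filter (\<lambda>e. k < fst e) (entries w) \<noteq> []"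
    using bw_length_high[of k w] first_letter_bounds[OF assms(1)] assms
    by (metis entries_eq_Nil entries_high list.map_disc_iff diff_is_0_eq' not_le order.strict_trans2 zero_less_diff)
  ultimately show "first_letter (high k w) = first_letter w - k" "first_label (high k w) = first_label w"
    by (simp_all add: first_letter_def first_label_def entries_high hd_map)
qed

section \<open>Shuffles and thresholds\<close>

text \<open>If the property \<open>P\<close> singles out the positions \<open>a, ..., b - 1\<close> of \<open>xs\<close>, then moving the
  entries of \<open>xs\<close> by \<open>\<alpha>\<close> keeps these entries in order exactly if \<open>\<alpha>\<close> is increasing there.\<close>
lemma filter_permute_list:
  assumes \<alpha>: "\<alpha> permutes {..<n}" and n: "length xs = n" "b \<le> n"
    and P: "\<And>i. i < n \<Longrightarrow> P (xs ! i) \<longleftrightarrow> i \<in> {a..<b}"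
  shows "strict_mono_on {a..<b} \<alpha> \<Longrightarrow> filter P (permute_list (inv \<alpha>) xs) = map ((!) xs) [a..<b]"
    and "\<lbrakk>filter P (permute_list (inv \<alpha>) xs) = map ((!) xs) [a..<b]; distinct xs\<rbrakk>
          \<Longrightarrow> strict_mono_on {a..<b} \<alpha>"
proof -
  have inv: "inv \<alpha> i < n" if "i < n" for i
    using permutes_in_image[OF permutes_inv[OF \<alpha>]] that by simp
  have \<alpha>n: "\<alpha> i < n" if "i < n" for i
    using permutes_in_image[OF \<alpha>] that by simp
  have inv_\<alpha>: "inv \<alpha> (\<alpha> i) = i" "\<alpha> (inv \<alpha> i) = i" for i
    using permutes_inverses[OF \<alpha>] by auto
  define idx where "idx = filter (\<lambda>i. inv \<alpha> i \<in> {a..<b}) [0..<n]"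
  have "filter P (permute_list (inv \<alpha>) xs) =
      map (\<lambda>i. xs ! inv \<alpha> i) (filter (\<lambda>i. P (xs ! inv \<alpha> i)) [0..<n])"
    by (simp add: permute_list_def filter_map o_def n)
  also have "filter (\<lambda>i. P (xs ! inv \<alpha> i)) [0..<n] = idx"
    unfolding idx_def using P inv by (intro filter_cong) auto
  finally have perm: "filter P (permute_list (inv \<alpha>) xs) = map (\<lambda>i. xs ! inv \<alpha> i) idx" .
  have "set idx = \<alpha> ` {a..<b}"
  proof (rule set_eqI)
    fix i
    have "i \<in> \<alpha> ` {a..<b} \<longleftrightarrow> inv \<alpha> i \<in> {a..<b}"
      by (metis imageE imageI inv_\<alpha>)
    moreover have "inv \<alpha> i \<in> {a..<b} \<Longrightarrow> i < n"
      using \<alpha>n[of "inv \<alpha> i"] n(2) by (simp add: inv_\<alpha>)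
    ultimately show "i \<in> set idx \<longleftrightarrow> i \<in> \<alpha> ` {a..<b}"
      by (auto simp: idx_def)
  qed
  show "filter P (permute_list (inv \<alpha>) xs) = map ((!) xs) [a..<b]"
    if mono: "strict_mono_on {a..<b} \<alpha>"
  proof -
    have "idx = map \<alpha> [a..<b]"
    proof (rule sorted_distinct_set_unique)
      show "sorted idx" "distinct idx" by (auto simp: idx_def sorted_wrt_filter)
      show "sorted (map \<alpha> [a..<b])"
        using strict_mono_onD[OF mono] by (auto simp: sorted_iff_nth_mono_less intro!: less_imp_le)
      show "distinct (map \<alpha> [a..<b])"
        using permutes_inj_on[OF \<alpha>] by (simp add: distinct_map)
      show "set idx = set (map \<alpha> [a..<b])" using \<open>set idx = _\<close> by simp
    qed
    then show ?thesis unfolding perm by (simp add: inv_\<alpha>)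
  qed
  show "strict_mono_on {a..<b} \<alpha>"
    if eq: "filter P (permute_list (inv \<alpha>) xs) = map ((!) xs) [a..<b]" and dist: "distinct xs"
  proof -
    have eq': "map (\<lambda>i. xs ! inv \<alpha> i) idx = map ((!) xs) [a..<b]" using eq perm by simp
    then have len: "length idx = b - a" by (metis length_map length_upt)
    have nth: "idx ! j = \<alpha> (a + j)" if "j < b - a" for j
    proof -
      have "xs ! inv \<alpha> (idx ! j) = xs ! (a + j)"
        using arg_cong[OF eq', of "\<lambda>ys. ys ! j"] that len by simp
      moreover have "idx ! j < n"
        using nth_mem[of j "idx"] that len by (auto simp: idx_def)
      ultimately have "inv \<alpha> (idx ! j) = a + j"
        using dist that n inv by (simp add: nth_eq_iff_index_eq)
      then show ?thesis by (metis inv_\<alpha>(2))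
    qed
    have sorted: "sorted_wrt (<) idx" by (simp add: idx_def sorted_wrt_filter)
    show ?thesis
    proof (rule strict_mono_onI)
      fix r s assume "r \<in> {a..<b}" "s \<in> {a..<b}" "r < s"
      then show "\<alpha> r < \<alpha> s"
        using nth[of "r - a"] nth[of "s - a"] len
          sorted_wrt_nth_less[OF sorted, of "r - a" "s - a"] by auto
    qed
  qed
qed

lemma distinct_mapI: "distinct (map f xs) \<Longrightarrow> distinct xs"
  by (simp add: distinct_map)

text \<open>The columns of \<open>u \<otimes> v\<close>, the word to which the shuffling permutation is applied.\<close>
definition juxtapose :: "biword \<Rightarrow> biword \<Rightarrow> (nat \<times> nat) list" where
  "juxtapose u v = entries u @ map (apfst (\<lambda>s. s + bw_length u)) (entries v)"

lemma juxtapose_props: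
  shows "length (juxtapose u v) = bw_length u + bw_length v"
    and "distinct (juxtapose u v)"
    and "i < bw_length u + bw_length v \<Longrightarrow> fst (juxtapose u v ! i) \<le> bw_length u \<longleftrightarrow> i < bw_length u"
    and "map ((!) (juxtapose u v)) [0..<bw_length u] = entries u"
    and "map ((!) (juxtapose u v)) [bw_length u..<bw_length u + bw_length v] =
          map (apfst (\<lambda>s. s + bw_length u)) (entries v)"
proof -
  show len: "length (juxtapose u v) = bw_length u + bw_length v" by (simp add: juxtapose_def)
  have uv: "fst e \<in> {1..bw_length w}" if "e \<in> set (entries w)" for e w
    using that set_entries(1)[of w] by blast
  have "map fst (juxtapose u v) = top_row u @ map (\<lambda>s. s + bw_length u) (top_row v)"
    by (simp add: juxtapose_def rows_eq)
  moreover have "distinct (top_row u @ map (\<lambda>s. s + bw_length u) (top_row v))"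
    by (auto simp: rep_biword_cases(1,2) distinct_map)
  ultimately have "distinct (map fst (juxtapose u v))" by (simp only:)
  then show "distinct (juxtapose u v)" by (rule distinct_mapI)
  show "fst (juxtapose u v ! i) \<le> bw_length u \<longleftrightarrow> i < bw_length u"
    if "i < bw_length u + bw_length v"
  proof (cases "i < bw_length u")
    case True
    then show ?thesis using uv[OF nth_mem, of i u] by (simp add: juxtapose_def nth_append)
  next
    case False
    then show ?thesis using uv[OF nth_mem, of "i - bw_length u" v] less_diff_conv2[of "bw_length u" i "bw_length v"] that
      by (auto simp: juxtapose_def nth_append)
  qed
  show "map ((!) (juxtapose u v)) [0..<bw_length u] = entries u"
    by (rule nth_equalityI) (auto simp: juxtapose_def nth_append)
  show "map ((!) (juxtapose u v)) [bw_length u..<bw_length u + bw_length v] =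
      map (apfst (\<lambda>s. s + bw_length u)) (entries v)"
    by (rule nth_equalityI) (auto simp: juxtapose_def nth_append)
qed

lemma entries_shuffle:
  assumes "\<alpha> \<in> shuffle_perms (bw_length u) (bw_length v)"
  shows "entries (shuffle_biword u v \<alpha>) = permute_list (inv \<alpha>) (juxtapose u v)"
proof -
  let ?xs = "juxtapose u v"
  have p: "inv \<alpha> permutes {..<length ?xs}"
    using assms by (auto simp: shuffle_perms_def juxtapose_props(1) intro: permutes_inv)
  have "top_row u @ map (\<lambda>j. j + bw_length u) (top_row v) = map fst ?xs"
    "bottom_row u @ bottom_row v = map snd ?xs"
    by (simp_all add: rows_eq juxtapose_def)
  then show ?thesis
    unfolding entries_def[of "shuffle_biword u v \<alpha>"] rep_shuffle_biword[OF assms]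
    by (simp add: permute_list_map[OF p] zip_map_fst_snd)
qed

lemma low_high_eq_iff:
  assumes "bw_length u \<le> bw_length w"
  shows "low (bw_length u) w = u \<longleftrightarrow> filter (\<lambda>e. fst e \<le> bw_length u) (entries w) = entries u"
    and "high (bw_length u) w = v \<longleftrightarrow> filter (\<lambda>e. bw_length u < fst e) (entries w) =
          map (apfst (\<lambda>s. s + bw_length u)) (entries v)"
proof -
  show "low (bw_length u) w = u \<longleftrightarrow> filter (\<lambda>e. fst e \<le> bw_length u) (entries w) = entries u"
    by (simp flip: entries_inject add: entries_low)
  let ?F = "filter (\<lambda>e. bw_length u < fst e) (entries w)"
  have "map (apfst (\<lambda>s. s + bw_length u)) (map (apfst (\<lambda>s. s - bw_length u)) ?F) = ?F"
    by (rule nth_equalityI) (auto simp: apfst_def map_prod_def split_beta dest!: nth_mem intro!: prod_eqI)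
  moreover have "map (apfst (\<lambda>s. s - bw_length u)) (map (apfst (\<lambda>s. s + bw_length u)) es) = es"
    for es :: "(nat \<times> nat) list"
    by (simp add: o_def apfst_def map_prod_def split_beta)
  ultimately have "map (apfst (\<lambda>s. s - bw_length u)) ?F = entries v \<longleftrightarrow>
      ?F = map (apfst (\<lambda>s. s + bw_length u)) (entries v)" by metis
  then show "high (bw_length u) w = v \<longleftrightarrow> ?F = map (apfst (\<lambda>s. s + bw_length u)) (entries v)"
    by (simp flip: entries_inject add: entries_high)
qed

text \<open>A shuffle of \<open>u\<close> and \<open>v\<close> can be taken apart by comparing letters with the length of \<open>u\<close>,
  and since letters are distinct it determines the permutation. So a sum over permutations is
  a sum over a set of biwords, each occurring once.\<close>
lemma shuffle_biword_bij:
  "bij_betw (shuffle_biword u v) (shuffle_perms (bw_length u) (bw_length v))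
     {w. bw_length w = bw_length u + bw_length v \<and> low (bw_length u) w = u \<and> high (bw_length u) w = v}"
    (is "bij_betw _ ?A ?B")
proof -
  let ?k = "bw_length u" and ?l = "bw_length v" and ?xs = "juxtapose u v"
  note xs = juxtapose_props[where u = u and v = v]
  have inj: "inj_on (shuffle_biword u v) ?A"
  proof (rule inj_onI)
    fix \<alpha> \<beta> assume ab: "\<alpha> \<in> ?A" "\<beta> \<in> ?A" "shuffle_biword u v \<alpha> = shuffle_biword u v \<beta>"
    then have eq: "permute_list (inv \<alpha>) ?xs = permute_list (inv \<beta>) ?xs"
      by (metis entries_shuffle)
    have p: "\<alpha> permutes {..<?k + ?l}" "\<beta> permutes {..<?k + ?l}"
      using ab by (auto simp: shuffle_perms_def)
    have "inv \<alpha> i = inv \<beta> i" for i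
    proof (cases "i < ?k + ?l")
      case True
      then have "?xs ! inv \<alpha> i = ?xs ! inv \<beta> i"
        using arg_cong[OF eq, of "\<lambda>ys. ys ! i"] by (simp add: permute_list_def xs)
      moreover have "inv \<alpha> i < ?k + ?l" "inv \<beta> i < ?k + ?l"
        using True permutes_in_image[OF permutes_inv[OF p(1)]]
          permutes_in_image[OF permutes_inv[OF p(2)]] by auto
      ultimately show ?thesis using xs(1,2) by (simp add: nth_eq_iff_index_eq)
    next
      case False
      then show ?thesis
        using permutes_not_in[OF permutes_inv[OF p(1)]] permutes_not_in[OF permutes_inv[OF p(2)]]
        by simp
    qed
    then show "\<alpha> = \<beta>"
      using p by (metis ext permutes_inv_inv)
  qed
  have P: "fst (?xs ! i) \<le> ?k \<longleftrightarrow> i \<in> {0..<?k}" "?k < fst (?xs ! i) \<longleftrightarrow> i \<in> {?k..<?k + ?l}"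
    if "i < ?k + ?l" for i
    using xs(3)[of i] that by auto
  have "shuffle_biword u v \<alpha> \<in> ?B" if \<alpha>: "\<alpha> \<in> ?A" for \<alpha>
  proof -
    have p: "\<alpha> permutes {..<?k + ?l}" "strict_mono_on {0..<?k} \<alpha>" "strict_mono_on {?k..<?k + ?l} \<alpha>"
      using \<alpha> by (auto simp: shuffle_perms_def atLeast0LessThan)
    show ?thesis
      using filter_permute_list(1)[OF p(1) xs(1) _ P(1) p(2)] filter_permute_list(1)[OF p(1) xs(1) _ P(2) p(3)]
      by (simp add: bw_length_shuffle[OF \<alpha>] low_high_eq_iff entries_shuffle[OF \<alpha>] xs)
  qed
  moreover have "w \<in> shuffle_biword u v ` ?A" if w: "w \<in> ?B" for w
  proof -
    have f: "filter (\<lambda>e. fst e \<le> ?k) (entries w) = entries u"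
      "filter (\<lambda>e. ?k < fst e) (entries w) = map (apfst (\<lambda>s. s + ?k)) (entries v)"
      using w low_high_eq_iff(1)[of u w] low_high_eq_iff(2)[of u w v] by auto
    have "mset (entries w) = mset (filter (\<lambda>e. fst e \<le> ?k) (entries w)) +
        mset (filter (\<lambda>e. ?k < fst e) (entries w))"
      by (simp add: mset_filter not_le[symmetric])
    then have "mset (entries w) = mset ?xs"
      unfolding f by (simp add: juxtapose_def)
    then obtain q where q: "q permutes {..<length ?xs}" "permute_list q ?xs = entries w"
      by (rule mset_eq_permutation)
    define \<alpha> where "\<alpha> = inv q"
    have p: "\<alpha> permutes {..<?k + ?l}" and inv: "inv \<alpha> = q"
      using q(1) by (auto simp: \<alpha>_def xs permutes_inv permutes_inv_inv)
    have "strict_mono_on {0..<?k} \<alpha>"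
      by (rule filter_permute_list(2)[OF p xs(1) _ P(1) _ xs(2)]) (simp_all add: inv q f xs)
    moreover have "strict_mono_on {?k..<?k + ?l} \<alpha>"
      by (rule filter_permute_list(2)[OF p xs(1) _ P(2) _ xs(2)]) (simp_all add: inv q f xs)
    ultimately have \<alpha>: "\<alpha> \<in> ?A"
      using p by (simp add: shuffle_perms_def atLeast0LessThan)
    then have "entries (shuffle_biword u v \<alpha>) = entries w"
      by (simp add: entries_shuffle inv q)
    then show ?thesis using \<alpha> by (auto simp: entries_inject)
  qed
  ultimately show ?thesis using inj by (auto simp: bij_betw_def)
qed

lemma first_letter_shuffle:
  assumes \<alpha>: "\<alpha> \<in> shuffle_perms (bw_length u) (bw_length v)"
    and pos: "bw_length u > 0" "bw_length v > 0"
  shows "inv \<alpha> 0 = 0 \<longleftrightarrow> first_letter (shuffle_biword u v \<alpha>) \<le> bw_length u"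
    and "inv \<alpha> 0 = bw_length u \<longleftrightarrow> bw_length u < first_letter (shuffle_biword u v \<alpha>)"
proof -
  let ?k = "bw_length u" and ?l = "bw_length v"
  note xs = juxtapose_props[where u = u and v = v]
  have p: "\<alpha> permutes {..<?k + ?l}" "strict_mono_on {..<?k} \<alpha>" "strict_mono_on {?k..<?k + ?l} \<alpha>"
    using \<alpha> by (auto simp: shuffle_perms_def)
  define j where "j = inv \<alpha> 0"
  have j: "\<alpha> j = 0" "j < ?k + ?l"
    using permutes_inverses[OF p(1)] permutes_in_image[OF permutes_inv[OF p(1)], of 0] pos
    by (auto simp: j_def)
  have "j = 0" if "j < ?k"
    using strict_mono_onD[OF p(2), of 0 j] that j by auto
  moreover have "j = ?k" if "\<not> j < ?k"
    using strict_mono_onD[OF p(3), of ?k j] that j by force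
  moreover have "first_letter (shuffle_biword u v \<alpha>) = fst (juxtapose u v ! j)"
  proof -
    have "permute_list (inv \<alpha>) (juxtapose u v) \<noteq> []"
      using xs(1) pos by (metis add_is_0 length_0_conv length_permute_list less_numeral_extra(3))
    then show ?thesis
      using pos by (simp add: first_letter_def entries_shuffle[OF \<alpha>] hd_conv_nth permute_list_def xs j_def)
  qed
  ultimately show "inv \<alpha> 0 = 0 \<longleftrightarrow> first_letter (shuffle_biword u v \<alpha>) \<le> ?k"
    "inv \<alpha> 0 = ?k \<longleftrightarrow> ?k < first_letter (shuffle_biword u v \<alpha>)"
    using xs(3)[OF j(2)] pos unfolding j_def[symmetric] by (cases "j < ?k"; linarith)+
qed

section \<open>Coefficients of products and the dendriform axioms\<close>

lemma lookup_sum_basis: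
  "finite I \<Longrightarrow> Poly_Mapping.lookup (\<Sum>i\<in>I. basis_elt (F i)) k = of_nat (card {i \<in> I. F i = k})"
  by (simp add: lookup_sum lookup_single when_def sum.If_cases Int_def)

lemma lookup_sum_basis_inj:
  assumes "finite I" "inj_on F I"
  shows "Poly_Mapping.lookup (\<Sum>i\<in>I. basis_elt (F i)) k = of_bool (k \<in> F ` I)"
proof (cases "k \<in> F ` I")
  case True
  then obtain i where "i \<in> I" "F i = k" by blast
  then have "{i \<in> I. F i = k} = {i}" using assms(2) by (auto dest: inj_onD)
  then show ?thesis using True assms(1) by (simp add: lookup_sum_basis)
next
  case False
  then have "{i \<in> I. F i = k} = {}" by auto
  then show ?thesis using False assms(1) by (simp add: lookup_sum_basis)
qed

lemma finite_shuffle_perms: "finite (shuffle_perms k l)"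
  by (rule finite_subset[OF _ finite_permutations[of "{..<k + l}"]]) (auto simp: shuffle_perms_def)

lemma lookup_half_shuffle:
  assumes pos: "bw_length u > 0" "bw_length v > 0"
  shows "Poly_Mapping.lookup (lt_bw u v) w =
           of_bool (bw_length w = bw_length u + bw_length v \<and> low (bw_length u) w = u \<and>
             high (bw_length u) w = v \<and> first_letter w \<le> bw_length u)"
    and "Poly_Mapping.lookup (gt_bw u v) w =
           of_bool (bw_length w = bw_length u + bw_length v \<and> low (bw_length u) w = u \<and>
             high (bw_length u) w = v \<and> bw_length u < first_letter w)"
proof -
  let ?A = "shuffle_perms (bw_length u) (bw_length v)" and ?f = "shuffle_biword u v"
  have inj: "inj_on ?f {\<alpha> \<in> ?A. P \<alpha>}" for P
    using shuffle_biword_bij[of u v] by (auto simp: bij_betw_def intro: inj_on_subset)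
  have fin: "finite {\<alpha> \<in> ?A. P \<alpha>}" for P
    using finite_shuffle_perms by auto
  have img: "w \<in> ?f ` ?A \<longleftrightarrow> bw_length w = bw_length u + bw_length v \<and> low (bw_length u) w = u \<and>
      high (bw_length u) w = v"
    using shuffle_biword_bij[of u v] by (auto simp: bij_betw_def)
  have "w \<in> ?f ` {\<alpha> \<in> ?A. inv \<alpha> 0 = 0} \<longleftrightarrow> w \<in> ?f ` ?A \<and> first_letter w \<le> bw_length u"
    "w \<in> ?f ` {\<alpha> \<in> ?A. inv \<alpha> 0 = bw_length u} \<longleftrightarrow> w \<in> ?f ` ?A \<and> bw_length u < first_letter w"
    using first_letter_shuffle[OF _ pos] by auto
  then show "Poly_Mapping.lookup (lt_bw u v) w =
        of_bool (bw_length w = bw_length u + bw_length v \<and> low (bw_length u) w = u \<and>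
          high (bw_length u) w = v \<and> first_letter w \<le> bw_length u)"
    "Poly_Mapping.lookup (gt_bw u v) w =
        of_bool (bw_length w = bw_length u + bw_length v \<and> low (bw_length u) w = u \<and>
          high (bw_length u) w = v \<and> bw_length u < first_letter w)"
    unfolding lt_bw_def gt_bw_def using pos
    by (simp_all add: lookup_sum_basis_inj[OF fin inj] img)
qed

lemma sum_single_cut:
  assumes "finite K" "K \<subseteq> {..bw_length w}"
  shows "(\<Sum>k\<in>K. Poly_Mapping.lookup (basis_elt u) (low k w) * Poly_Mapping.lookup (basis_elt v) (high k w)) =
    (of_bool (bw_length u \<in> K \<and> low (bw_length u) w = u \<and> high (bw_length u) w = v) :: rat)"
proof -
  have "(\<Sum>k\<in>K. Poly_Mapping.lookup (basis_elt u) (low k w) * Poly_Mapping.lookup (basis_elt v) (high k w)) =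
    (\<Sum>k\<in>K. if k = bw_length u then of_bool (low (bw_length u) w = u \<and> high (bw_length u) w = v) else (0::rat))"
  proof (rule sum.cong[OF refl])
    fix k assume "k \<in> K"
    then have "k \<le> bw_length w" using assms(2) by auto
    then have "low k w = u \<Longrightarrow> k = bw_length u"
      using bw_length_low[of k w] by auto
    then have "low k w = u \<and> high k w = v \<longleftrightarrow>
        k = bw_length u \<and> low (bw_length u) w = u \<and> high (bw_length u) w = v"
      by metis
    moreover have "Poly_Mapping.lookup (basis_elt u) (low k w) * Poly_Mapping.lookup (basis_elt v) (high k w) =
        (of_bool (low k w = u \<and> high k w = v) :: rat)"
      by (simp add: lookup_single when_def eq_commute)
    ultimately show "Poly_Mapping.lookup (basis_elt u) (low k w) * Poly_Mapping.lookup (basis_elt v) (high k w) =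
      (if k = bw_length u then of_bool (low (bw_length u) w = u \<and> high (bw_length u) w = v) else (0::rat))"
      by simp
  qed
  then show ?thesis using assms(1) by simp
qed

text \<open>An identity between bilinear expressions, stated as the vanishing of a bilinear form,
  need only be checked on nonempty biwords.\<close>
lemma S_plus_induct2:
  assumes "x \<in> S_plus" "y \<in> S_plus"
    and "\<And>u v. \<lbrakk>bw_length u > 0; bw_length v > 0\<rbrakk> \<Longrightarrow> F (basis_elt u) (basis_elt v) = (0::rat)"
    and "\<And>x x' y. F (x + x') y = F x y + F x' y" "\<And>x y y'. F x (y + y') = F x y + F x y'"
    and "\<And>c x y. F (qscale c x) y = c * F x y" "\<And>c x y. F x (qscale c y) = c * F x y"
  shows "F x y = 0"
proof -
  have zero: "F 0 y = 0" "F x 0 = 0" for x y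
    using assms(6)[of 0 x y] assms(7)[of x 0 y] by simp_all
  have "F (basis_elt u) y = 0" if "bw_length u > 0" for u
    using assms(2) unfolding S_plus_def
    by (induction rule: fs.span_induct_alt) (use assms(3-) that in \<open>auto simp: zero\<close>)
  with assms(1) show ?thesis
    unfolding S_plus_def by (induction rule: fs.span_induct_alt) (use assms(3-) in \<open>auto simp: zero\<close>)
qed

text \<open>The products are dual to cutting \<open>w\<close> by the values of its letters. The threshold
  \<open>k = bw_length w\<close> in the first sum and \<open>k = 0\<close> in the second contribute nothing, because one of
  the two words is empty; they make the ranges for both products add up to all thresholds.\<close>
lemma lookup_S_products:
  assumes xy: "x \<in> S_plus" "y \<in> S_plus" and w: "bw_length w > 0"
  shows lookup_S_lt: "Poly_Mapping.lookup (S_lt x y) w =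
      (\<Sum>k=first_letter w..bw_length w. Poly_Mapping.lookup x (low k w) * Poly_Mapping.lookup y (high k w))"
    and lookup_S_gt: "Poly_Mapping.lookup (S_gt x y) w =
      (\<Sum>k<first_letter w. Poly_Mapping.lookup x (low k w) * Poly_Mapping.lookup y (high k w))"
proof -
  have dims: "bw_length w = bw_length u + bw_length v"
    if "low (bw_length u) w = u" "high (bw_length u) w = v" "bw_length u \<le> bw_length w" for u v
    using that bw_length_low[of "bw_length u" w] bw_length_high[of "bw_length u" w] by simp
  have *: "Poly_Mapping.lookup (S_lt (basis_elt u) (basis_elt v)) w =
      (\<Sum>k=first_letter w..bw_length w.
         Poly_Mapping.lookup (basis_elt u) (low k w) * Poly_Mapping.lookup (basis_elt v) (high k w))"
    "Poly_Mapping.lookup (S_gt (basis_elt u) (basis_elt v)) w =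
      (\<Sum>k<first_letter w.
         Poly_Mapping.lookup (basis_elt u) (low k w) * Poly_Mapping.lookup (basis_elt v) (high k w))"
    if "bw_length u > 0" "bw_length v > 0" for u v
  proof -
    define C where "C \<longleftrightarrow> low (bw_length u) w = u \<and> high (bw_length u) w = v"
    have "bw_length u \<le> bw_length w \<Longrightarrow> C \<Longrightarrow> bw_length w = bw_length u + bw_length v"
      using dims by (simp add: C_def)
    then have iff: "bw_length w = bw_length u + bw_length v \<and> C \<and> first_letter w \<le> bw_length u \<longleftrightarrow>
        bw_length u \<in> {first_letter w..bw_length w} \<and> C"
      "bw_length w = bw_length u + bw_length v \<and> C \<and> bw_length u < first_letter w \<longleftrightarrow>
        bw_length u \<in> {..<first_letter w} \<and> C"
      using first_letter_bounds[OF w] unfolding atLeastAtMost_iff lessThan_iff by linarith+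
    have "{first_letter w..bw_length w} \<subseteq> {..bw_length w}" "{..<first_letter w} \<subseteq> {..bw_length w}"
      using first_letter_bounds[OF w] by auto
    then show "Poly_Mapping.lookup (S_lt (basis_elt u) (basis_elt v)) w =
      (\<Sum>k=first_letter w..bw_length w.
         Poly_Mapping.lookup (basis_elt u) (low k w) * Poly_Mapping.lookup (basis_elt v) (high k w))"
    "Poly_Mapping.lookup (S_gt (basis_elt u) (basis_elt v)) w =
      (\<Sum>k<first_letter w.
         Poly_Mapping.lookup (basis_elt u) (low k w) * Poly_Mapping.lookup (basis_elt v) (high k w))"
      using iff unfolding C_def
      by (simp_all only: S_lt_def S_gt_def bilinear_ext_simps lookup_half_shuffle[OF that]
          sum_single_cut finite_atLeastAtMost finite_lessThan conj_assoc)
  qed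
  note simps = S_lt_def S_gt_def bilinear_ext_simps lookup_add algebra_simps
    sum.distrib sum_subtractf sum_distrib_left
  have "Poly_Mapping.lookup (S_lt x y) w - (\<Sum>k=first_letter w..bw_length w.
      Poly_Mapping.lookup x (low k w) * Poly_Mapping.lookup y (high k w)) = 0"
    using xy by (rule S_plus_induct2[where F = "\<lambda>x y. Poly_Mapping.lookup (S_lt x y) w -
        (\<Sum>k=first_letter w..bw_length w. Poly_Mapping.lookup x (low k w) * Poly_Mapping.lookup y (high k w))"])
      (simp_all add: *, simp_all add: simps)
  moreover have "Poly_Mapping.lookup (S_gt x y) w - (\<Sum>k<first_letter w.
      Poly_Mapping.lookup x (low k w) * Poly_Mapping.lookup y (high k w)) = 0"
    using xy by (rule S_plus_induct2[where F = "\<lambda>x y. Poly_Mapping.lookup (S_gt x y) w -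
        (\<Sum>k<first_letter w. Poly_Mapping.lookup x (low k w) * Poly_Mapping.lookup y (high k w))"])
      (simp_all add: *, simp_all add: simps)
  ultimately show "Poly_Mapping.lookup (S_lt x y) w =
      (\<Sum>k=first_letter w..bw_length w. Poly_Mapping.lookup x (low k w) * Poly_Mapping.lookup y (high k w))"
    "Poly_Mapping.lookup (S_gt x y) w =
      (\<Sum>k<first_letter w. Poly_Mapping.lookup x (low k w) * Poly_Mapping.lookup y (high k w))"
    by simp_all
qed

lemma lookup_S_plus_0: "\<lbrakk>x \<in> S_plus; bw_length w = 0\<rbrakk> \<Longrightarrow> Poly_Mapping.lookup x w = 0"
  using lookup_empty_S_plus by (simp add: bw_length_eq_0_iff)

lemma lookup_S_star:
  assumes xy: "x \<in> S_plus" "y \<in> S_plus"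
  shows "Poly_Mapping.lookup (S_lt x y + S_gt x y) w =
      (\<Sum>k\<le>bw_length w. Poly_Mapping.lookup x (low k w) * Poly_Mapping.lookup y (high k w))"
proof (cases "bw_length w = 0")
  case True
  then have "Poly_Mapping.lookup x (low 0 w) = 0" by (simp add: xy lookup_S_plus_0 bw_length_low)
  then show ?thesis using True lookup_S_plus_0 S_plus_closed[OF xy] by (simp add: lookup_add)
next
  case False
  then have w: "bw_length w > 0" by simp
  have "{..bw_length w} = {..<first_letter w} \<union> {first_letter w..bw_length w}"
    using first_letter_bounds[OF w] by auto
  then show ?thesis
    by (simp add: lookup_add lookup_S_products[OF xy w] sum.union_disjoint ivl_disj_int add.commute)
qed

lemma sum_shift_cuts:
  fixes f :: "nat \<Rightarrow> 'c::comm_monoid_add"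
  shows "\<lbrakk>k \<le> a; k \<le> b\<rbrakk> \<Longrightarrow> (\<Sum>j=a - k..b - k. f (k + j)) = (\<Sum>m=a..b. f m)"
    and "(\<Sum>j<b - k. f (k + j)) = (\<Sum>m=k..<b. f m)"
  by (rule sum.reindex_bij_witness[of _ "\<lambda>m. m - k" "\<lambda>j. k + j"]; auto)
     (rule sum.reindex_bij_witness[of _ "\<lambda>m. m - k" "\<lambda>j. k + j"]; auto)

lemma S_plus_eqI:
  assumes "x \<in> S_plus" "y \<in> S_plus"
    and "\<And>w. bw_length w > 0 \<Longrightarrow> Poly_Mapping.lookup x w = Poly_Mapping.lookup y w"
  shows "x = y"
proof (rule poly_mapping_eqI)
  fix w
  show "Poly_Mapping.lookup x w = Poly_Mapping.lookup y w"
    using assms lookup_S_plus_0 by (cases "bw_length w = 0") auto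
qed

text \<open>Both sides of each axiom sum, over pairs of thresholds \<open>k \<le> m\<close>, the coefficients of the
  three words formed by the letters up to \<open>k\<close>, between \<open>k\<close> and \<open>m\<close>, and beyond \<open>m\<close>. The axioms
  differ in where the first letter of \<open>w\<close> lies relative to \<open>k\<close> and \<open>m\<close>.\<close>
lemma S_dendriform_axioms:
  assumes x: "x \<in> S_plus" and y: "y \<in> S_plus" and z: "z \<in> S_plus"
  shows "S_lt (S_lt x y) z = S_lt x (S_lt y z + S_gt y z)"
    and "S_lt (S_gt x y) z = S_gt x (S_lt y z)"
    and "S_gt (S_lt x y + S_gt x y) z = S_gt x (S_gt y z)"
proof -
  let ?l = Poly_Mapping.lookup
  have star: "S_lt a b + S_gt a b \<in> S_plus" if "a \<in> S_plus" "b \<in> S_plus" for a b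
    using S_plus_closed[OF that] fs.subspace_add[OF subspace_S_plus] by blast
  note cl = S_plus_closed star
  define g where "g w k m = ?l x (low k w) * ?l y (high k (low m w)) * ?l z (high m w)" for w k m
  have shift: "?l x (low k w) * (?l y (low j (high k w)) * ?l z (high j (high k w))) = g w k (k + j)"
    for w k j
    by (simp add: g_def high_low high_high)
  show "S_lt (S_lt x y) z = S_lt x (S_lt y z + S_gt y z)"
  proof (rule S_plus_eqI)
    fix w assume w: "bw_length w > 0"
    let ?n = "bw_length w" and ?h = "first_letter w"
    have "?l (S_lt (S_lt x y) z) w = (\<Sum>m=?h..?n. \<Sum>k | k \<in> {?h..?n} \<and> k \<le> m. g w k m)"
      unfolding lookup_S_lt[OF cl(1)[OF x y] z w]
    proof (rule sum.cong[OF refl])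
      fix m assume m: "m \<in> {?h..?n}"
      then have m': "bw_length (low m w) = m" "first_letter (low m w) = ?h" "m > 0"
        using w first_letter_bounds(1)[OF w] by (auto simp: bw_length_low first_low)
      have "{k. k \<in> {?h..?n} \<and> k \<le> m} = {?h..m}" using m by auto
      then show "?l (S_lt x y) (low m w) * ?l z (high m w) = (\<Sum>k | k \<in> {?h..?n} \<and> k \<le> m. g w k m)"
        using m' by (simp add: lookup_S_lt[OF x y] sum_distrib_right g_def low_low)
    qed
    also have "\<dots> = (\<Sum>k=?h..?n. \<Sum>m | m \<in> {?h..?n} \<and> k \<le> m. g w k m)"
      by (rule sum.swap_restrict) auto
    also have "\<dots> = ?l (S_lt x (S_lt y z + S_gt y z)) w"
      unfolding lookup_S_lt[OF x cl(3)[OF y z] w]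
    proof (rule sum.cong[OF refl])
      fix k assume k: "k \<in> {?h..?n}"
      have "{m. m \<in> {?h..?n} \<and> k \<le> m} = {k..?n}" using k by auto
      then show "(\<Sum>m | m \<in> {?h..?n} \<and> k \<le> m. g w k m) =
          ?l x (low k w) * ?l (S_lt y z + S_gt y z) (high k w)"
        using sum_shift_cuts(1)[of k k ?n "g w k"] k
        by (simp add: lookup_S_star[OF y z] sum_distrib_left shift bw_length_high atMost_atLeast0)
    qed
    finally show "?l (S_lt (S_lt x y) z) w = ?l (S_lt x (S_lt y z + S_gt y z)) w" .
  qed (use x y z cl in auto)
  show "S_lt (S_gt x y) z = S_gt x (S_lt y z)"
  proof (rule S_plus_eqI)
    fix w assume w: "bw_length w > 0"
    let ?n = "bw_length w" and ?h = "first_letter w"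
    have "?l (S_lt (S_gt x y) z) w = (\<Sum>m=?h..?n. \<Sum>k<?h. g w k m)"
      unfolding lookup_S_lt[OF cl(2)[OF x y] z w]
    proof (rule sum.cong[OF refl])
      fix m assume m: "m \<in> {?h..?n}"
      then have m': "bw_length (low m w) = m" "first_letter (low m w) = ?h" "m > 0"
        using w first_letter_bounds(1)[OF w] by (auto simp: bw_length_low first_low)
      then show "?l (S_gt x y) (low m w) * ?l z (high m w) = (\<Sum>k<?h. g w k m)"
        using m by (simp add: lookup_S_gt[OF x y] sum_distrib_right g_def low_low)
    qed
    also have "\<dots> = (\<Sum>k<?h. \<Sum>m=?h..?n. g w k m)"
      by (rule sum.swap)
    also have "\<dots> = ?l (S_gt x (S_lt y z)) w"
      unfolding lookup_S_gt[OF x cl(1)[OF y z] w]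
    proof (rule sum.cong[OF refl])
      fix k assume k: "k \<in> {..<?h}"
      then have k': "bw_length (high k w) > 0" "first_letter (high k w) = ?h - k"
        using first_letter_bounds(2)[OF w] w by (auto simp: bw_length_high first_high)
      show "(\<Sum>m=?h..?n. g w k m) = ?l x (low k w) * ?l (S_lt y z) (high k w)"
        using sum_shift_cuts(1)[of k ?h ?n "g w k"] k first_letter_bounds(2)[OF w]
        by (simp add: lookup_S_lt[OF y z k'(1)] k'(2) sum_distrib_left shift bw_length_high)
    qed
    finally show "?l (S_lt (S_gt x y) z) w = ?l (S_gt x (S_lt y z)) w" .
  qed (use x y z cl in auto)
  show "S_gt (S_lt x y + S_gt x y) z = S_gt x (S_gt y z)"
  proof (rule S_plus_eqI)
    fix w assume w: "bw_length w > 0"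
    let ?n = "bw_length w" and ?h = "first_letter w"
    have "?l (S_gt (S_lt x y + S_gt x y) z) w = (\<Sum>m<?h. \<Sum>k | k \<in> {..<?h} \<and> k \<le> m. g w k m)"
      unfolding lookup_S_gt[OF cl(3)[OF x y] z w]
    proof (rule sum.cong[OF refl])
      fix m assume m: "m \<in> {..<?h}"
      then have "bw_length (low m w) = m"
        using first_letter_bounds(2)[OF w] by (auto simp: bw_length_low)
      moreover have "{k. k \<in> {..<?h} \<and> k \<le> m} = {..m}" using m by auto
      ultimately show "?l (S_lt x y + S_gt x y) (low m w) * ?l z (high m w) =
          (\<Sum>k | k \<in> {..<?h} \<and> k \<le> m. g w k m)"
        by (simp add: lookup_S_star[OF x y] sum_distrib_right g_def low_low)
    qed
    also have "\<dots> = (\<Sum>k<?h. \<Sum>m | m \<in> {..<?h} \<and> k \<le> m. g w k m)"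
      by (rule sum.swap_restrict) auto
    also have "\<dots> = ?l (S_gt x (S_gt y z)) w"
      unfolding lookup_S_gt[OF x cl(2)[OF y z] w]
    proof (rule sum.cong[OF refl])
      fix k assume k: "k \<in> {..<?h}"
      then have k': "bw_length (high k w) > 0" "first_letter (high k w) = ?h - k"
        using first_letter_bounds(2)[OF w] w by (auto simp: bw_length_high first_high)
      have "{m. m \<in> {..<?h} \<and> k \<le> m} = {k..<?h}" by auto
      then show "(\<Sum>m | m \<in> {..<?h} \<and> k \<le> m. g w k m) = ?l x (low k w) * ?l (S_gt y z) (high k w)"
        using sum_shift_cuts(2)[where f = "g w k" and k = k and b = ?h]
        by (simp add: lookup_S_gt[OF y z k'(1)] k'(2) sum_distrib_left shift)
    qed
    finally show "?l (S_gt (S_lt x y + S_gt x y) z) w = ?l (S_gt x (S_gt y z)) w" .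
  qed (use x y z cl in auto)
qed

lemma dendriform_subalgebra:
  assumes "fs.subspace V" "V \<subseteq> S_plus" "\<And>x y. \<lbrakk>x \<in> V; y \<in> V\<rbrakk> \<Longrightarrow> S_lt x y \<in> V \<and> S_gt x y \<in> V"
  shows "dendriform_algebra qscale V S_lt S_gt"
proof -
  have V: "x \<in> S_plus" if "x \<in> V" for x using that assms(2) by blast
  show ?thesis
    by unfold_locales
      (use assms(1,3) V S_dendriform_axioms in
        \<open>auto simp: S_lt_def[THEN fun_cong, THEN fun_cong] S_gt_def[THEN fun_cong, THEN fun_cong]
          bilinear_ext_simps\<close>)
qed

interpretation S: dendriform_algebra qscale S_plus S_lt S_gt
  by (rule dendriform_subalgebra) (auto simp: subspace_S_plus S_plus_closed)

lemma entries_length_1: "bw_length w = 1 \<longleftrightarrow> (\<exists>a. entries w = [(1, a)])"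
proof
  assume "bw_length w = 1"
  then obtain e where "entries w = [e]"
    by (metis One_nat_def length_0_conv length_Suc_conv length_entries)
  then show "\<exists>a. entries w = [(1, a)]"
    using set_entries(1)[of w] \<open>bw_length w = 1\<close> by (cases e) auto
qed (metis One_nat_def length_Cons length_entries list.size(3))

lemma lookup_pi:
  assumes "a \<ge> 1"
  shows "Poly_Mapping.lookup (pi_elt a) w = of_bool (bw_length w = 1 \<and> first_label w = a)"
proof -
  have "entries (Biword ([1], [a])) = [(1, a)]"
    using rep_pi_biword[OF assms] by (simp add: entries_def)
  then have "Biword ([1], [a]) = w \<longleftrightarrow> entries w = [(1, a)]"
    by (metis entries_inject)
  also have "\<dots> \<longleftrightarrow> bw_length w = 1 \<and> first_label w = a"
    using entries_length_1 by (auto simp: first_label_def)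
  finally show ?thesis
    by (simp add: pi_elt_def lookup_single when_def)
qed

lemma pi_in_S_plus: "a \<ge> 1 \<Longrightarrow> pi_elt a \<in> S_plus"
  unfolding pi_elt_def using rep_pi_biword by (intro basis_in_S_plus) (simp add: bw_length_def)

lemma lookup_lt_pi:
  assumes a: "a \<ge> 1" and y: "y \<in> S_plus" and w: "bw_length w > 0"
  shows "Poly_Mapping.lookup (S_lt (pi_elt a) y) w =
    of_bool (first_letter w = 1 \<and> first_label w = a) * Poly_Mapping.lookup y (high 1 w)"
proof -
  have "Poly_Mapping.lookup (S_lt (pi_elt a) y) w =
      (\<Sum>k=first_letter w..bw_length w.
        if k = 1 then of_bool (first_label w = a) * Poly_Mapping.lookup y (high 1 w) else 0)"
    unfolding lookup_S_lt[OF pi_in_S_plus[OF a] y w]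
    by (rule sum.cong[OF refl]) (use w in \<open>auto simp: lookup_pi[OF a] bw_length_low first_low\<close>)
  also have "\<dots> = (if first_letter w = 1 then of_bool (first_label w = a) * Poly_Mapping.lookup y (high 1 w) else 0)"
    using first_letter_bounds[OF w] by (simp add: sum.delta; linarith)
  finally show ?thesis by simp
qed

lemma lookup_gt_pi:
  assumes a: "a \<ge> 1" and y: "y \<in> S_plus" and w: "bw_length w > 0"
  shows "Poly_Mapping.lookup (S_gt y (pi_elt a)) w =
    of_bool (first_letter w = bw_length w \<and> first_label w = a) * Poly_Mapping.lookup y (low (bw_length w - 1) w)"
proof -
  have "Poly_Mapping.lookup (S_gt y (pi_elt a)) w =
      (\<Sum>k<first_letter w. if k = bw_length w - 1
        then of_bool (first_label w = a) * Poly_Mapping.lookup y (low (bw_length w - 1) w) else 0)"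
    unfolding lookup_S_gt[OF y pi_in_S_plus[OF a] w]
    by (rule sum.cong[OF refl]) (use w first_letter_bounds[OF w] in
        \<open>auto simp: lookup_pi[OF a] bw_length_high first_high\<close>)
  also have "\<dots> = (if first_letter w = bw_length w
      then of_bool (first_label w = a) * Poly_Mapping.lookup y (low (bw_length w - 1) w) else 0)"
    using first_letter_bounds[OF w] w by (simp add: sum.delta; linarith)
  finally show ?thesis by simp
qed

section \<open>Binary search trees of biwords\<close>

text \<open>The tree that results from inserting the letters from left to right into a binary search
  tree; nodes keep only the bottom entries.\<close>
function word_tree :: "biword \<Rightarrow> nat tree" where
  "word_tree w = (if bw_length w = 0 then Leaf
     else Node (word_tree (low (first_letter w - 1) w)) (first_label w) (word_tree (high (first_letter w) w)))"
  by auto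
termination
proof (relation "measure bw_length")
  fix w assume "bw_length w \<noteq> 0"
  then show "(low (first_letter w - 1) w, w) \<in> measure bw_length"
    "(high (first_letter w) w, w) \<in> measure bw_length"
    using first_letter_bounds[of w] by (auto simp: bw_length_low bw_length_high)
qed simp

declare word_tree.simps [simp del]

lemma word_tree_eq_Leaf: "word_tree w = Leaf \<longleftrightarrow> bw_length w = 0"
  by (simp add: word_tree.simps[of w])

lemma word_tree_eq_Node:
  "word_tree w = Node l a r \<longleftrightarrow> bw_length w > 0 \<and> first_label w = a \<and>
     word_tree (low (first_letter w - 1) w) = l \<and> word_tree (high (first_letter w) w) = r"
  by (auto simp: word_tree.simps[of w])

text \<open>The coefficient formula for \<open>(m\<^sub>l \<succ> \<pi>\<^sub>a) \<prec> m\<^sub>r\<close> at \<open>w\<close> has one surviving pair of thresholds,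
  around the first letter \<open>h\<close> of \<open>w\<close>: a biword of length one must be left between them. So \<open>l\<close>, \<open>a\<close>
  and \<open>r\<close> are matched with the letters below \<open>h\<close>, the label of \<open>h\<close>, and the letters above \<open>h\<close>,
  as in the recursion for \<open>word_tree\<close>.\<close>
lemma lookup_monomial:
  assumes "T \<in> trees_over {1..}"
  shows "Poly_Mapping.lookup (S.tree_monomial pi_elt T) w = of_bool (word_tree w = T)"
  using assms
proof (induction T arbitrary: w)
  case (Node l a r)
  let ?l = Poly_Mapping.lookup and ?m = "S.tree_monomial pi_elt"
  have pi: "\<forall>i\<in>{1..}. pi_elt i \<in> S_plus" using pi_in_S_plus by auto
  have a: "a \<ge> 1" using Node.prems by auto
  define c where "c = (if l = Leaf then pi_elt a else S_gt (?m l) (pi_elt a))"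
  have l: "?m l \<in> S_plus" if "l \<noteq> Leaf"
    using that Node.prems by (intro S.monomial_closed[OF pi]) auto
  have r: "?m r \<in> S_plus" if "r \<noteq> Leaf"
    using that Node.prems by (intro S.monomial_closed[OF pi]) auto
  have c: "c \<in> S_plus" using a pi_in_S_plus l S_plus_closed by (simp add: c_def)
  have lookup_c: "?l c w = of_bool (first_letter w = bw_length w \<and> first_label w = a \<and>
      word_tree (low (first_letter w - 1) w) = l)" if w: "bw_length w > 0" for w
  proof (cases "l = Leaf")
    case True
    then show ?thesis
      using w first_letter_bounds[OF w] by (auto simp: c_def lookup_pi[OF a] word_tree_eq_Leaf bw_length_low)
  next
    case False
    then have "?l (?m l) w' = of_bool (word_tree w' = l)" for w'
      using Node by auto
    then show ?thesis
      using False by (auto simp: c_def lookup_gt_pi[OF a l w])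
  qed
  have m: "?m (Node l a r) = (if r = Leaf then c else S_lt c (?m r))"
    by (simp add: c_def Let_def)
  show ?case
  proof (cases "bw_length w = 0")
    case True
    then have "word_tree w = Leaf" by (simp add: word_tree_eq_Leaf)
    then show ?thesis
      using True lookup_S_plus_0 S.monomial_closed[OF pi Node.prems] by simp
  next
    case False
    then have w: "bw_length w > 0" by simp
    let ?h = "first_letter w"
    show ?thesis
    proof (cases "r = Leaf")
      case True
      then have "?l (?m (Node l a r)) w = ?l c w"
        by (subst m) simp
      then show ?thesis
        using True w first_letter_bounds[OF w]
        by (auto simp: lookup_c[OF w] word_tree_eq_Node word_tree_eq_Leaf bw_length_high
            simp del: S.tree_monomial.simps)
    next
      case False
      then have lr: "?l (?m r) w' = of_bool (word_tree w' = r)" for w'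
        using Node by auto
      have "?l (?m (Node l a r)) w = (\<Sum>k=?h..bw_length w. ?l c (low k w) * ?l (?m r) (high k w))"
        using False by (simp only: m if_False lookup_S_lt[OF c r[OF False] w])
      also have "\<dots> = (\<Sum>k=?h..bw_length w. if k = ?h then of_bool (word_tree w = Node l a r) else 0)"
      proof (rule sum.cong[OF refl])
        fix k assume k: "k \<in> {?h..bw_length w}"
        then have "bw_length (low k w) > 0" "first_letter (low k w) = ?h" "bw_length (low k w) = k"
          "first_label (low k w) = first_label w" "low (?h - 1) (low k w) = low (?h - 1) w"
          using w first_letter_bounds[OF w] by (auto simp: bw_length_low first_low low_low)
        then show "?l c (low k w) * ?l (?m r) (high k w) =
            (if k = ?h then of_bool (word_tree w = Node l a r) else 0)"
          using w by (auto simp: lookup_c lr word_tree_eq_Node)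
      qed
      also have "\<dots> = of_bool (word_tree w = Node l a r)"
        using first_letter_bounds[OF w] by simp
      finally show ?thesis .
    qed
  qed
qed simp

lemma ex_word_tree:
  assumes "set_tree T \<subseteq> {1..}"
  shows "\<exists>w. word_tree w = T"
  using assms
proof (induction T)
  case Leaf
  show ?case by (rule exI[of _ empty_biword]) (simp add: word_tree_eq_Leaf bw_length_eq_0_iff)
next
  case (Node l a r)
  then obtain u v where uv: "word_tree u = l" "word_tree v = r" by auto
  let ?k = "bw_length u"
  \<comment> \<open>the root letter, then the letters of the left subtree, then those of the right one\<close>
  define es where "es = (?k + 1, a) # entries u @ map (apfst (\<lambda>s. s + (?k + 1))) (entries v)"
  have u: "fst e \<in> {1..?k}" if "e \<in> set (entries u)" for e
    using that set_entries(1)[of u] by blast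
  have v: "fst e \<in> {1..bw_length v}" if "e \<in> set (entries v)" for e
    using that set_entries(1)[of v] by blast
  have es: "entries (bw_of es) = es"
  proof (rule entries_bw_of)
    have "map fst es = (?k + 1) # top_row u @ map (\<lambda>s. s + (?k + 1)) (top_row v)"
      by (simp add: es_def rows_eq)
    moreover have "distinct ((?k + 1) # top_row u @ map (\<lambda>s. s + (?k + 1)) (top_row v))"
      by (auto simp: rep_biword_cases(1,2) distinct_map inj_on_def)
    ultimately show "distinct (map fst es)" by (simp only:)
    have "fst ` set es = {?k + 1} \<union> fst ` set (entries u) \<union> (\<lambda>s. s + (?k + 1)) ` fst ` set (entries v)"
      by (simp add: es_def image_Un image_image)
    also have "\<dots> = {?k + 1} \<union> {1..?k} \<union> {1 + (?k + 1)..bw_length v + (?k + 1)}"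
      by (simp only: set_entries image_add_atLeastAtMost')
    finally show "fst ` set es = {1..?k + 1 + bw_length v}"
      by auto
    show "0 \<notin> snd ` set es"
      using Node.prems set_entries(2)[of u] set_entries(2)[of v] by (force simp: es_def)
  qed
  let ?w = "bw_of es"
  have first: "first_letter ?w = ?k + 1" "first_label ?w = a"
    by (simp_all add: first_letter_def first_label_def es, simp_all add: es_def)
  have "filter (\<lambda>e. fst e \<le> ?k) es = entries u"
    using u by (auto simp: es_def filter_map o_def filter_empty_conv intro!: filter_True)
  then have "low ?k ?w = u"
    by (simp flip: entries_inject add: entries_low es)
  moreover have "high (?k + 1) ?w = v"
  proof -
    have "filter (\<lambda>e. ?k + 1 < fst e) es = map (apfst (\<lambda>s. s + (?k + 1))) (entries v)"
    proof -
      have "filter (\<lambda>e. ?k + 1 < fst e) (entries u) = []"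
        using u by (fastforce simp: filter_empty_conv)
      moreover have "filter (\<lambda>e. ?k + 1 < fst e) (map (apfst (\<lambda>s. s + (?k + 1))) (entries v)) =
          map (apfst (\<lambda>s. s + (?k + 1))) (entries v)"
        using v by (intro filter_True) fastforce
      ultimately show ?thesis by (simp add: es_def)
    qed
    then show ?thesis
      by (simp flip: entries_inject add: entries_high es o_def apfst_def map_prod_def split_beta)
  qed
  moreover have "bw_length ?w > 0"
    by (metis es es_def length_entries length_greater_0_conv list.distinct(1))
  ultimately have "word_tree ?w = Node l a r"
    by (simp add: word_tree_eq_Node first uv)
  then show ?case ..
qed

section \<open>The dendriform descent algebra\<close>

lemma entries_high_1:
  assumes "bw_length w > 0" "first_letter w = 1"
  shows "entries w = (1, first_label w) # map (apfst Suc) (entries (high 1 w))"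
proof -
  obtain es where es: "entries w = (1, first_label w) # es"
    using assms by (cases "entries w") (auto simp: first_letter_def first_label_def entries_eq_Nil)
  have gt: "1 < fst e" if "e \<in> set es" for e
  proof -
    have "fst e \<noteq> 1"
      using distinct_entries[of w] that by (force simp: es)
    moreover have "fst e \<in> {1..bw_length w}"
      using set_entries(1)[of w] that by (auto simp: es)
    ultimately show ?thesis by simp
  qed
  then have "filter (\<lambda>e. 1 < fst e) es = es"
    by (intro filter_True) auto
  then have "entries (high 1 w) = map (apfst (\<lambda>s. s - 1)) es"
    by (simp add: entries_high es)
  moreover have "map (apfst Suc) (map (apfst (\<lambda>s. s - 1)) es) = es"
    unfolding map_map
  proof (rule map_idI)
    fix e assume "e \<in> set es"
    then have "1 < fst e" by (rule gt)
    then show "(apfst Suc \<circ> apfst (\<lambda>s. s - 1)) e = e"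
      by (simp add: prod_eq_iff)
  qed
  ultimately show ?thesis by (simp add: es)
qed

definition identity_word :: "nat \<Rightarrow> biword \<Rightarrow> bool" where
  "identity_word n w \<longleftrightarrow> top_row w = [1..<Suc (bw_length w)] \<and> sum_list (bottom_row w) = n"

lemma lookup_p_elt:
  assumes n: "n \<ge> 1"
  shows "Poly_Mapping.lookup (p_elt n) w = of_bool (identity_word n w)"
proof -
  define D where "D k = {d. length d = k \<and> 0 \<notin> set d \<and> sum_list d = n}" for k :: nat
  define F where "F = (\<lambda>(k, d). Biword ([1..<Suc k], d))"
  have fin: "finite (Sigma {1..n} D)"
    unfolding D_def using finite_compositions by auto
  have rep: "rep_biword (F (k, d)) = ([1..<Suc k], d)" if "d \<in> D k" for k d
    unfolding F_def prod.case by (rule rep_p_biword) (use that in \<open>auto simp: D_def\<close>)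
  have inj: "inj_on F (Sigma {1..n} D)"
  proof (rule inj_onI)
    fix a b assume "a \<in> Sigma {1..n} D" "b \<in> Sigma {1..n} D" and eq: "F a = F b"
    then obtain k d l e where ab: "a = (k, d)" "b = (l, e)" "d \<in> D k" "e \<in> D l" by blast
    then have "d = e" using rep[OF ab(3)] rep[OF ab(4)] eq by simp
    then show "a = b" using ab by (simp add: D_def)
  qed
  have p: "p_elt n = (\<Sum>a\<in>Sigma {1..n} D. basis_elt (F a))"
  proof -
    have "p_elt n = (\<Sum>k=1..n. \<Sum>d\<in>D k. basis_elt (F (k, d)))"
      using n by (simp add: p_elt_def D_def F_def)
    also have "\<dots> = (\<Sum>a\<in>Sigma {1..n} D. basis_elt (F a))"
      by (subst sum.Sigma) (auto simp: D_def finite_compositions)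
    finally show ?thesis .
  qed
  have img: "w \<in> F ` Sigma {1..n} D \<longleftrightarrow> identity_word n w"
  proof
    assume "w \<in> F ` Sigma {1..n} D"
    then obtain k d where kd: "d \<in> D k" "w = F (k, d)" by auto
    then show "identity_word n w"
      using rep[OF kd(1)] by (simp add: identity_word_def D_def bw_length_def del: upt_Suc)
  next
    assume w: "identity_word n w"
    have le: "length d \<le> sum_list d" if "0 \<notin> set d" for d :: "nat list"
      using that by (induction d) auto
    have "bw_length w \<le> n"
      using le[of "bottom_row w"] w rep_biword_cases(3,4)[of w] by (simp add: identity_word_def)
    moreover have "bw_length w \<noteq> 0"
      using w n by (auto simp: identity_word_def rows_eq simp flip: entries_eq_Nil)
    ultimately have "(bw_length w, bottom_row w) \<in> Sigma {1..n} D"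
      using w rep_biword_cases(3,4)[of w] by (auto simp: identity_word_def D_def)
    moreover have "w = F (bw_length w, bottom_row w)"
      using rep[of "bottom_row w" "bw_length w"] calculation w
      by (metis SigmaD2 identity_word_def prod.collapse rep_biword_inject)
    ultimately show "w \<in> F ` Sigma {1..n} D" by blast
  qed
  show ?thesis
    unfolding p lookup_sum_basis_inj[OF fin inj] img ..
qed

lemma identity_word_rec:
  assumes "n \<ge> 1" "bw_length w > 0"
  shows "identity_word n w \<longleftrightarrow> bw_length w = 1 \<and> first_label w = n \<or>
    first_letter w = 1 \<and> first_label w < n \<and> identity_word (n - first_label w) (high 1 w)"
proof (cases "first_letter w = 1")
  case True
  note e = entries_high_1[OF assms(2) True]
  have "top_row w = 1 # map Suc (top_row (high 1 w))"
    "bottom_row w = first_label w # bottom_row (high 1 w)"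
    by (simp_all add: rows_eq e)
  moreover have len: "bw_length w = Suc (bw_length (high 1 w))"
    using assms(2) by (simp add: bw_length_high)
  moreover have "[1..<Suc (Suc m)] = 1 # map Suc [1..<Suc m]" for m
    by (simp add: map_Suc_upt upt_conv_Cons del: upt_Suc)
  ultimately have iff: "identity_word n w \<longleftrightarrow>
      top_row (high 1 w) = [1..<Suc (bw_length (high 1 w))] \<and> first_label w + sum_list (bottom_row (high 1 w)) = n"
    by (simp add: identity_word_def inj_map_eq_map del: upt_Suc)
  show ?thesis
  proof (cases "bw_length w = 1")
    case one: True
    then have "entries (high 1 w) = []" using len by (simp add: entries_eq_Nil)
    then show ?thesis
      using one True len iff by (auto simp: identity_word_def rows_eq)
  next
    case False
    then have "bottom_row (high 1 w) \<noteq> []"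
      using len rep_biword_cases(3)[of "high 1 w"] by auto
    then have "sum_list (bottom_row (high 1 w)) > 0"
      using rep_biword_cases(4)[of "high 1 w"] by (cases "bottom_row (high 1 w)") auto
    then show ?thesis
      using False True iff by (auto simp: identity_word_def)
  qed
next
  case False
  have "first_letter w = hd (top_row w)"
    using assms(2) by (simp add: first_letter_def rows_eq hd_map entries_eq_Nil)
  then have "\<not> identity_word n w"
    using False assms(2) by (auto simp: identity_word_def hd_upt simp del: upt_Suc)
  moreover have "bw_length w \<noteq> 1"
    using False first_letter_bounds[OF assms(2)] by auto
  ultimately show ?thesis using False by simp
qed

text \<open>An identity word of length at least two is \<open>\<pi>\<^sub>i \<prec> v\<close> for its first label \<open>i\<close> and a shorter
  identity word \<open>v\<close>. The recursion is triangular, so each of the families \<open>p\<close> and \<open>\<pi>\<close> can be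
  expressed by the other.\<close>
lemma p_elt_rec:
  assumes n: "n \<ge> 1"
  shows "p_elt n = pi_elt n + (\<Sum>i=1..<n. S_lt (pi_elt i) (p_elt (n - i)))"
proof (rule S_plus_eqI)
  show "p_elt n \<in> S_plus" using n by (rule p_elt_in_S_plus)
  show "pi_elt n + (\<Sum>i=1..<n. S_lt (pi_elt i) (p_elt (n - i))) \<in> S_plus"
    using n by (intro fs.subspace_add[OF subspace_S_plus] fs.subspace_sum[OF subspace_S_plus]
        S_plus_closed(1) pi_in_S_plus p_elt_in_S_plus) auto
next
  fix w assume w: "bw_length w > 0"
  let ?h = "first_letter w" and ?a = "first_label w"
  have a: "?a \<ge> 1"
  proof -
    have "?a \<in> snd ` set (entries w)" using w by (simp add: first_label_def entries_eq_Nil)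
    then show ?thesis using set_entries(2)[of w] by (cases "?a = 0") auto
  qed
  have "(\<Sum>i=1..<n. Poly_Mapping.lookup (S_lt (pi_elt i) (p_elt (n - i))) w) =
      (\<Sum>i=1..<n. if i = ?a then of_bool (?h = 1 \<and> identity_word (n - ?a) (high 1 w)) else 0)"
  proof (rule sum.cong[OF refl])
    fix i assume "i \<in> {1..<n}"
    then have i: "i \<ge> 1" "n - i \<ge> 1" by auto
    show "Poly_Mapping.lookup (S_lt (pi_elt i) (p_elt (n - i))) w =
        (if i = ?a then of_bool (?h = 1 \<and> identity_word (n - ?a) (high 1 w)) else 0)"
      by (simp add: lookup_lt_pi[OF i(1) p_elt_in_S_plus[OF i(2)] w] lookup_p_elt[OF i(2)])
  qed
  also have "\<dots> = of_bool (?h = 1 \<and> ?a < n \<and> identity_word (n - ?a) (high 1 w))"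
    using a by simp
  finally show "Poly_Mapping.lookup (p_elt n) w =
      Poly_Mapping.lookup (pi_elt n + (\<Sum>i=1..<n. S_lt (pi_elt i) (p_elt (n - i)))) w"
    using identity_word_rec[OF n w]
    by (auto simp: lookup_add lookup_sum lookup_p_elt[OF n] lookup_pi[OF n])
qed

lemma Descd_plus_eq_span_pi: "Descd_plus = dendriform_span (pi_elt ` {1..})"
proof
  note p = dendriform_span_closed[where X = "p_elt ` {1..}", folded Descd_plus_def]
  note q = dendriform_span_closed[where X = "pi_elt ` {1..}"]
  have "p_elt n \<in> dendriform_span (pi_elt ` {1..})" if "n \<ge> 1" for n
    using that
  proof (induction n rule: less_induct)
    case (less n)
    have "pi_elt i \<in> dendriform_span (pi_elt ` {1..})" if "i \<ge> 1" for i
      using q(1) that by auto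
    then show ?case
      unfolding p_elt_rec[OF less.prems] using less
      by (intro fs.subspace_add[OF q(2)] fs.subspace_sum[OF q(2)] q(3)) auto
  qed
  then show "Descd_plus \<subseteq> dendriform_span (pi_elt ` {1..})"
    unfolding Descd_plus_def by (intro dendriform_span_least) (use q in auto)
  have "pi_elt n \<in> Descd_plus" if "n \<ge> 1" for n
    using that
  proof (induction n rule: less_induct)
    case (less n)
    have "p_elt i \<in> Descd_plus" if "i \<ge> 1" for i
      using p(1) that by auto
    then have "p_elt n - (\<Sum>i=1..<n. S_lt (pi_elt i) (p_elt (n - i))) \<in> Descd_plus"
      using less by (intro fs.subspace_diff[OF p(2)] fs.subspace_sum[OF p(2)] p(3)) auto
    then show ?case using p_elt_rec[OF less.prems] by simp
  qed
  then show "dendriform_span (pi_elt ` {1..}) \<subseteq> Descd_plus"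
    by (intro dendriform_span_least) (use p in auto)
qed

interpretation D: dendriform_algebra qscale Descd_plus S_lt S_gt
  by (rule dendriform_subalgebra)
     (use dendriform_span_closed[where X = "p_elt ` {1..}", folded Descd_plus_def] Descd_plus_subset in auto)

lemma pi_in_Descd: "n \<ge> 1 \<Longrightarrow> pi_elt n \<in> Descd_plus"
  using dendriform_span_closed(1)[of "pi_elt ` {1..}"] by (auto simp: Descd_plus_eq_span_pi)

lemma Descd_plus_eq_span_monomials:
  "fs.span (D.tree_monomial pi_elt ` trees_over {1..}) = Descd_plus" (is "?W = _")
proof
  have pi: "\<forall>i\<in>{1..}. pi_elt i \<in> Descd_plus" using pi_in_Descd by auto
  show "?W \<subseteq> Descd_plus"
    by (rule D.span_subset_A) (use D.monomial_closed[OF pi] in blast)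
  show "Descd_plus \<subseteq> ?W"
    unfolding Descd_plus_eq_span_pi
  proof (rule dendriform_span_least)
    show "pi_elt ` {1..} \<subseteq> ?W"
    proof (rule image_subsetI)
      fix n :: nat assume "n \<in> {1..}"
      then show "pi_elt n \<in> ?W"
        by (intro fs.span_base image_eqI[of _ _ "Node Leaf n Leaf"]) auto
    qed
  qed (use D.monomial_span_closed[OF pi] in auto)
qed

lemma independent_if_private_keys:
  assumes "\<And>v. v \<in> X \<Longrightarrow> \<exists>k. Poly_Mapping.lookup v k \<noteq> 0 \<and> (\<forall>v'\<in>X - {v}. Poly_Mapping.lookup v' k = 0)"
  shows "fs.independent X"
  unfolding fs.dependent_def
proof safe
  fix v assume v: "v \<in> X" "v \<in> fs.span (X - {v})"
  obtain k where k: "Poly_Mapping.lookup v k \<noteq> 0" "\<forall>v'\<in>X - {v}. Poly_Mapping.lookup v' k = 0"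
    using assms[OF v(1)] by blast
  from v(2) have "Poly_Mapping.lookup v k = 0"
    by (induction rule: fs.span_induct_alt) (use k(2) in \<open>auto simp: lookup_add\<close>)
  with k(1) show False by simp
qed

lemma monomials_independent:
  "inj_on (D.tree_monomial pi_elt) (trees_over {1..})"
  "fs.independent (D.tree_monomial pi_elt ` trees_over {1..})"
proof -
  let ?m = "D.tree_monomial pi_elt"
  show inj: "inj_on ?m (trees_over {1..})"
  proof (rule inj_onI)
    fix S T assume ST: "S \<in> trees_over {1..}" "T \<in> trees_over {1..}" "?m S = ?m T"
    obtain w where "word_tree w = S" using ex_word_tree ST(1) by blast
    then have "Poly_Mapping.lookup (?m T) w = 1"
      using lookup_monomial[OF ST(1), of w] ST(3) by simp
    then show "S = T"
      using lookup_monomial[OF ST(2), of w] \<open>word_tree w = S\<close> by (simp split: if_splits)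
  qed
  show "fs.independent (?m ` trees_over {1..})"
  proof (rule independent_if_private_keys)
    fix v assume "v \<in> ?m ` trees_over {1..}"
    then obtain T w where T: "T \<in> trees_over {1..}" "v = ?m T" "word_tree w = T"
      using ex_word_tree by blast
    have "Poly_Mapping.lookup v w \<noteq> 0"
      using lookup_monomial[OF T(1), of w] T by simp
    moreover have "Poly_Mapping.lookup v' w = 0" if v': "v' \<in> ?m ` trees_over {1..} - {v}" for v'
    proof -
      obtain T' where "T' \<in> trees_over {1..}" "v' = ?m T'" "T' \<noteq> T"
        using v' T(2) by blast
      then show ?thesis using lookup_monomial[of T' w] T(3) by simp
    qed
    ultimately show "\<exists>k. Poly_Mapping.lookup v k \<noteq> 0 \<and>
        (\<forall>v'\<in>?m ` trees_over {1..} - {v}. Poly_Mapping.lookup v' k = 0)"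
      by blast
  qed
qed

text \<open>Tree monomials are sums over all words with a given search tree, so coefficients in their
  span cannot tell such words apart. This invariance allows words to be rearranged below.\<close>
lemma Descd_plus_lookup_cong:
  assumes "x \<in> Descd_plus" "word_tree w = word_tree w'"
  shows "Poly_Mapping.lookup x w = Poly_Mapping.lookup x w'"
  using assms(1) unfolding Descd_plus_eq_span_monomials[symmetric]
  by (induction rule: fs.span_induct_alt) (auto simp: lookup_add lookup_monomial assms(2))

section \<open>Primitive elements\<close>

lemma lookup_linear_ext:
  "Poly_Mapping.lookup (linear_ext h x) k =
     (\<Sum>u\<in>Poly_Mapping.keys x. Poly_Mapping.lookup x u * Poly_Mapping.lookup (h u) k)"
  by (simp add: linear_ext_def lookup_sum)

lemma bw_length_cut:
  assumes "i \<le> bw_length w"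
  shows "bw_length (prefix_bw i w) = i" "bw_length (suffix_bw i w) = bw_length w - i"
proof -
  have "length (top_row w) = bw_length w" by (simp add: bw_length_def)
  then show "bw_length (prefix_bw i w) = i" "bw_length (suffix_bw i w) = bw_length w - i"
    using assms by (simp_all add: bw_length_def[of "prefix_bw i w"] bw_length_def[of "suffix_bw i w"]
        rep_prefix_bw rep_suffix_bw std_def)
qed

text \<open>Both half-coproducts sum the cuts of a word over a range \<open>C\<close> of positions. If the cut of
  \<open>w\<close> at \<open>m\<close> arises from no other word with a nonzero coefficient, then the coefficient of \<open>w\<close> is,
  up to a positive factor, a coefficient of the coproduct.\<close>
lemma isolate_cut:
  assumes x: "x \<in> S_plus"
    and zero: "linear_ext (\<lambda>u. \<Sum>i\<in>C u. basis_elt (prefix_bw i u, suffix_bw i u)) x = 0"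
    and C: "\<And>u. bw_length u > 0 \<Longrightarrow> C u \<subseteq> {1..<bw_length u}"
    and w: "bw_length w > 0" "m \<in> C w"
    and others: "\<And>v. \<lbrakk>v \<noteq> w; bw_length v = bw_length w; m \<in> C v;
        prefix_bw m v = prefix_bw m w; suffix_bw m v = suffix_bw m w\<rbrakk> \<Longrightarrow> Poly_Mapping.lookup x v = 0"
  shows "Poly_Mapping.lookup x w = 0"
proof (cases "w \<in> Poly_Mapping.keys x")
  case True
  define t where "t u = (of_nat (card {i \<in> C u. (prefix_bw i u, suffix_bw i u) =
      (prefix_bw m w, suffix_bw m w)}) :: rat)" for u
  have fin: "finite (C u)" if "bw_length u > 0" for u
    using C[OF that] finite_subset by blast
  have pos: "bw_length u > 0" if "u \<in> Poly_Mapping.keys x" for u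
    using that lookup_S_plus_0[OF x, of u] by (auto simp: in_keys_iff)
  have "0 = (\<Sum>u\<in>Poly_Mapping.keys x. Poly_Mapping.lookup x u * t u)"
    using arg_cong[OF zero, of "\<lambda>y. Poly_Mapping.lookup y (prefix_bw m w, suffix_bw m w)"]
    by (simp add: lookup_linear_ext lookup_sum_basis fin pos t_def)
  also have "\<dots> = Poly_Mapping.lookup x w * t w +
      (\<Sum>u\<in>Poly_Mapping.keys x - {w}. Poly_Mapping.lookup x u * t u)"
    by (rule sum.remove) (use True in auto)
  also have "(\<Sum>u\<in>Poly_Mapping.keys x - {w}. Poly_Mapping.lookup x u * t u) = 0"
  proof (rule sum.neutral, rule ballI)
    fix u assume u: "u \<in> Poly_Mapping.keys x - {w}"
    show "Poly_Mapping.lookup x u * t u = 0"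
    proof (cases "t u = 0")
      case False
      then obtain i where i: "i \<in> C u" "prefix_bw i u = prefix_bw m w" "suffix_bw i u = suffix_bw m w"
        by (auto simp: t_def card_eq_0_iff)
      have le: "i \<le> bw_length u" "m \<le> bw_length w"
        using C[of u] C[of w] i(1) w pos u by fastforce+
      have "i = m" using bw_length_cut(1)[OF le(1)] bw_length_cut(1)[OF le(2)] i(2) by simp
      moreover have "bw_length u = bw_length w"
        using bw_length_cut(2)[OF le(1)] bw_length_cut(2)[OF le(2)] i(3) le \<open>i = m\<close> by simp
      ultimately show ?thesis using others[of u] i u by simp
    qed simp
  qed
  finally have "Poly_Mapping.lookup x w * t w = 0" by simp
  moreover have "t w \<noteq> 0"
    using w fin[OF w(1)] by (auto simp: t_def card_eq_0_iff)
  ultimately show ?thesis by simp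
qed (simp add: in_keys_iff)

lemma std_inject:
  assumes "set xs = set ys" "std xs = std ys"
  shows "xs = ys"
proof (rule map_inj_on)
  show "map (\<lambda>x. card {y \<in> set xs. y \<le> x}) xs = map (\<lambda>x. card {y \<in> set xs. y \<le> x}) ys"
    using assms by (simp add: std_def)
  show "inj_on (\<lambda>x. card {y \<in> set xs. y \<le> x}) (set xs \<union> set ys)"
    using std_bij(2)[of xs] assms(1) by (simp add: bij_betw_def)
qed

text \<open>Cutting a word loses only the set of letters in its first part.\<close>
lemma cut_inject:
  assumes len: "bw_length v = bw_length w"
    and eq: "prefix_bw m v = prefix_bw m w" "suffix_bw m v = suffix_bw m w"
    and set: "set (take m (top_row v)) = set (take m (top_row w))"
  shows "v = w"
proof -
  have compl: "set (drop m (top_row u)) = {1..bw_length u} - set (take m (top_row u))" for u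
  proof -
    have "set (take m (top_row u)) \<inter> set (drop m (top_row u)) = {}"
      using rep_biword_cases(1)[of u] by (rule set_take_disj_set_drop_if_distinct) simp
    moreover have "set (take m (top_row u)) \<union> set (drop m (top_row u)) = {1..bw_length u}"
      using rep_biword_cases(2)[of u] by (simp flip: set_append)
    ultimately show ?thesis by auto
  qed
  have "std (take m (top_row v)) = std (take m (top_row w))"
    "std (drop m (top_row v)) = std (drop m (top_row w))"
    "take m (bottom_row v) = take m (bottom_row w)"
    "drop m (bottom_row v) = drop m (bottom_row w)"
    using arg_cong[OF eq(1), of rep_biword] arg_cong[OF eq(2), of rep_biword]
    by (simp_all add: rep_prefix_bw rep_suffix_bw)
  moreover have "set (drop m (top_row v)) = set (drop m (top_row w))"
    using compl[of v] compl[of w] set len by simp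
  ultimately have "top_row v = top_row w" "bottom_row v = bottom_row w"
    using set std_inject by (metis append_take_drop_id)+
  then show ?thesis by (metis prod.collapse rep_biword_inject)
qed

lemma pos_one_le_iff:
  assumes "bw_length w > 0"
  shows "pos_one w \<le> m \<longleftrightarrow> 1 \<in> set (take m (top_row w))"
proof -
  have p: "1 \<le> pos_one w" "pos_one w \<le> bw_length w" "top_row w ! (pos_one w - 1) = 1"
    using pos_one[of w] assms by auto
  show ?thesis
  proof
    assume "pos_one w \<le> m"
    then show "1 \<in> set (take m (top_row w))"
      using p by (auto simp: in_set_conv_nth bw_length_def intro!: exI[of _ "pos_one w - 1"])
  next
    assume "1 \<in> set (take m (top_row w))"
    then obtain j where "j < m" "j < bw_length w" "top_row w ! j = 1"
      by (auto simp: in_set_conv_nth bw_length_def)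
    then have "j = pos_one w - 1"
      using p nth_eq_iff_index_eq[OF rep_biword_cases(1)[of w], of j "pos_one w - 1"]
      by (simp add: bw_length_def)
    then show "pos_one w \<le> m" using \<open>j < m\<close> p by simp
  qed
qed

lemma top_row_Cons:
  assumes "bw_length w > 0"
  shows "top_row w = first_letter w # tl (top_row w)"
  using assms by (cases "entries w") (auto simp: rows_eq first_letter_def entries_eq_Nil)

text \<open>A first part of length one that contains the letter \<open>1\<close> leaves no choice of letters, so the
  cut after the first letter determines \<open>w\<close>.\<close>
lemma primitive_coefficient_first_one:
  assumes x: "x \<in> S_plus" "delta_lt x = 0" and w: "first_letter w = 1" "bw_length w \<ge> 2"
  shows "Poly_Mapping.lookup x w = 0"
proof (rule isolate_cut[OF x(1), where C = "\<lambda>u. {pos_one u..<bw_length u}" and m = 1])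
  show "linear_ext (\<lambda>u. \<Sum>i\<in>{pos_one u..<bw_length u}. basis_elt (prefix_bw i u, suffix_bw i u)) x = 0"
    using x(2) by (simp add: delta_lt_def delta_lt_bw_def[abs_def])
  show "{pos_one u..<bw_length u} \<subseteq> {1..<bw_length u}" if "bw_length u > 0" for u
    using pos_one(1)[of u] that by auto
  show "bw_length w > 0" using w by simp
  have take: "take 1 (top_row v) = [first_letter v]" if "bw_length v > 0" for v
    using top_row_Cons[OF that] by (metis One_nat_def take0 take_Suc_Cons)
  show "1 \<in> {pos_one w..<bw_length w}"
    using pos_one_le_iff[of w 1] take[of w] w by simp
  fix v assume v: "v \<noteq> w" "bw_length v = bw_length w" "1 \<in> {pos_one v..<bw_length v}"
    "prefix_bw 1 v = prefix_bw 1 w" "suffix_bw 1 v = suffix_bw 1 w"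
  have "first_letter v = 1"
    using pos_one_le_iff[of v 1] take[of v] v w by simp
  then have "v = w"
    using v w take[of v] take[of w] by (intro cut_inject[of v w 1]) auto
  with v(1) show "Poly_Mapping.lookup x v = 0" by simp
qed

text \<open>Insertion into a search tree below the root \<open>h\<close> treats the letters smaller and larger
  than \<open>h\<close> independently, so they may be separated.\<close>
lemma ex_big_letters_first:
  assumes w: "bw_length w > 0"
  obtains w' where "word_tree w' = word_tree w" "bw_length w' = bw_length w"
    "first_letter w' = first_letter w"
    "set (take (Suc (bw_length w) - first_letter w) (top_row w')) = {first_letter w..bw_length w}"
proof -
  let ?es = "entries w" and ?h = "first_letter w" and ?n = "bw_length w"
  define B where "B = filter (\<lambda>e. ?h \<le> fst e) ?es"
  define L where "L = filter (\<lambda>e. fst e < ?h) ?es"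
  have set: "set (B @ L) = set ?es" by (auto simp: B_def L_def)
  have dist: "distinct (map fst B)" "distinct (map fst L)"
    unfolding B_def L_def by (rule distinct_map_filter, rule distinct_entries)+
  have e: "entries (bw_of (B @ L)) = B @ L"
  proof (rule entries_bw_of)
    show "distinct (map fst (B @ L))"
      using dist by (auto simp: B_def L_def)
  qed (use set set_entries[of w] in auto)
  let ?w = "bw_of (B @ L)"
  have "length (B @ L) = ?n"
    using sum_length_filter_compl[of "\<lambda>e. ?h \<le> fst e" ?es] by (simp add: B_def L_def not_le)
  then have len: "bw_length ?w = ?n" by (metis e length_entries)
  have hd: "hd B = hd ?es" "B \<noteq> []"
  proof -
    have "?es \<noteq> []" using w by (simp add: entries_eq_Nil)
    then show "hd B = hd ?es" "B \<noteq> []"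
      by (cases ?es; simp add: B_def first_letter_def)+
  qed
  have first: "first_letter ?w = ?h" "first_label ?w = first_label w"
    using hd by (simp_all add: first_letter_def first_label_def e)
  have setB: "fst ` set B = {?h..?n}"
  proof -
    have "fst ` set B = fst ` set ?es \<inter> {?h..}" by (auto simp: B_def)
    then show ?thesis using first_letter_bounds[OF w] by (auto simp: set_entries)
  qed
  then have "length B = Suc ?n - ?h"
    using distinct_card[OF dist(1)] by simp
  then have "take (Suc ?n - ?h) (top_row ?w) = map fst B"
    by (simp add: rows_eq e)
  then have 1: "set (take (Suc ?n - ?h) (top_row ?w)) = {?h..?n}"
    using setB by simp
  have h: "fst e \<le> ?h - 1 \<longleftrightarrow> fst e < ?h" for e :: "nat \<times> nat"
    using first_letter_bounds[OF w] by auto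
  have "filter (\<lambda>e. fst e \<le> ?h - 1) (B @ L) = filter (\<lambda>e. fst e \<le> ?h - 1) ?es"
    "filter (\<lambda>e. ?h < fst e) (B @ L) = filter (\<lambda>e. ?h < fst e) ?es"
    unfolding h by (auto simp: B_def L_def filter_empty_conv intro!: filter_cong)
  then have "low (?h - 1) ?w = low (?h - 1) w" "high ?h ?w = high ?h w"
    by (simp_all flip: entries_inject add: entries_low entries_high e)
  then have "word_tree ?w = word_tree w"
    by (simp add: word_tree.simps[of ?w] word_tree.simps[of w] len first)
  then show ?thesis using that[of ?w] len first 1 by simp
qed

text \<open>After the rearrangement, the first part of length \<open>m\<close> consists of the \<open>m\<close> largest letters
  and starts with its minimum \<open>h\<close>. Another word \<open>v\<close> with the same cut also starts with the minimum
  of its first part, which is at most \<open>h\<close>, with equality only if the first part again has the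
  \<open>m\<close> largest letters. As \<open>1\<close> is required in the second part, \<open>v\<close> starts with a letter
  between \<open>1\<close> and \<open>h\<close> and is covered by the induction hypothesis.\<close>
lemma primitive_coefficient_first_gt:
  assumes x: "x \<in> Descd_plus" "delta_gt x = 0" and "first_letter w > 1" "bw_length w > 0"
  shows "Poly_Mapping.lookup x w = 0"
  using assms(3,4)
proof (induction "first_letter w" arbitrary: w rule: less_induct)
  case less
  let ?h = "first_letter w" and ?n = "bw_length w"
  define m where "m = Suc ?n - ?h"
  obtain w' where w': "word_tree w' = word_tree w" "bw_length w' = ?n" "first_letter w' = ?h"
    "set (take m (top_row w')) = {?h..?n}"
    using ex_big_letters_first[OF less.prems(2)] unfolding m_def by blast
  have n: "?h \<le> ?n" "m \<ge> 1"
    using first_letter_bounds[OF less.prems(2)] by (auto simp: m_def)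
  have head: "\<exists>t. take m (top_row v) = first_letter v # t" if "bw_length v > 0" for v
    using n(2) by (subst top_row_Cons[OF that]) (simp add: take_Cons')
  have "Poly_Mapping.lookup x w' = 0"
  proof (rule isolate_cut[where C = "\<lambda>u. {1..<pos_one u}" and m = m])
    show "x \<in> S_plus" using x(1) Descd_plus_subset by auto
    show "linear_ext (\<lambda>u. \<Sum>i\<in>{1..<pos_one u}. basis_elt (prefix_bw i u, suffix_bw i u)) x = 0"
      using x(2) by (simp add: delta_gt_def delta_gt_bw_def[abs_def])
    show "{1..<pos_one u} \<subseteq> {1..<bw_length u}" if "bw_length u > 0" for u
      using pos_one(2)[of u] that by auto
    show "bw_length w' > 0" using w' less.prems by simp
    then show "m \<in> {1..<pos_one w'}"
      using pos_one_le_iff[OF \<open>bw_length w' > 0\<close>, of m] n less.prems(1) unfolding w'(4)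
      by (simp only: atLeastLessThan_iff atLeastAtMost_iff simp_thms) linarith
    fix v assume v: "v \<noteq> w'" "bw_length v = bw_length w'" "m \<in> {1..<pos_one v}"
      "prefix_bw m v = prefix_bw m w'" "suffix_bw m v = suffix_bw m w'"
    have pos: "bw_length v > 0" "bw_length w' > 0" using v(2) w'(2) less.prems by auto
    obtain t where t: "take m (top_row v) = first_letter v # t" using head[OF pos(1)] by blast
    obtain t' where t': "take m (top_row w') = ?h # t'" using head[OF pos(2)] w'(3) by auto
    have sub: "set (take m (top_row v)) \<subseteq> {1..?n}"
      using rep_biword_cases(2)[of v] v(2) w'(2) by (auto dest: in_set_takeD)
    have "1 \<notin> set (take m (top_row v))"
      using pos_one_le_iff[OF pos(1), of m] v(3) by auto
    then have gt: "first_letter v > 1"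
      using t first_letter_bounds[OF pos(1)] by (cases "first_letter v = 1") auto
    \<comment> \<open>the rank of the first letter within the first part is preserved, and it is one\<close>
    have "std (take m (top_row v)) = std (take m (top_row w'))"
      using arg_cong[OF v(4), of rep_biword] by (simp add: rep_prefix_bw)
    then have "hd (std (take m (top_row v))) = hd (std (take m (top_row w')))" by simp
    then have "card {y \<in> set (take m (top_row v)). y \<le> first_letter v} =
        card {y \<in> set (take m (top_row w')). y \<le> ?h}"
      by (simp add: std_def t t' del: set_simps)
    also have "{y \<in> set (take m (top_row w')). y \<le> ?h} = {?h}"
      unfolding w'(4) using n by auto
    finally have "card {y \<in> set (take m (top_row v)). y \<le> first_letter v} = 1" by simp
    then obtain c where c: "{y \<in> set (take m (top_row v)). y \<le> first_letter v} = {c}"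
      by (rule card_1_singletonE)
    have min: "first_letter v \<le> y" if "y \<in> set (take m (top_row v))" for y
    proof (rule ccontr)
      assume "\<not> first_letter v \<le> y"
      then have "y \<in> {c}" "first_letter v \<in> {c}"
        using that t unfolding c[symmetric] by auto
      with \<open>\<not> first_letter v \<le> y\<close> show False by simp
    qed
    show "Poly_Mapping.lookup x v = 0"
    proof (cases "first_letter v < ?h")
      case True
      then show ?thesis using less.hyps[of v] gt pos by simp
    next
      case False
      then have "set (take m (top_row v)) \<subseteq> {?h..?n}" using min sub by force
      moreover have "card (set (take m (top_row v))) = m"
      proof -
        have "distinct (take m (top_row v))" using rep_biword_cases(1)[of v] by simp
        then show ?thesis
          using v(2) w'(2) less.prems(1) by (simp add: distinct_card m_def flip: bw_length_def)
      qed
      ultimately have "set (take m (top_row v)) = {?h..?n}"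
        by (intro card_subset_eq) (auto simp: m_def)
      then have "v = w'" using v w'(4) by (intro cut_inject[of v w' m]) auto
      with v(1) show ?thesis by simp
    qed
  qed
  then show ?case using Descd_plus_lookup_cong[OF x(1) w'(1)] by simp
qed

lemma pi_elt_basis:
  assumes "bw_length w = 1"
  shows "basis_elt w = pi_elt (first_label w)" "first_label w \<ge> 1"
proof -
  obtain a where a: "entries w = [(1, a)]" using assms entries_length_1 by blast
  have l: "first_label w = a" by (simp add: first_label_def a)
  have "a \<noteq> 0" using set_entries(2)[of w] a by auto
  then show "first_label w \<ge> 1" using l by simp
  show "basis_elt w = pi_elt (first_label w)"
  proof -
    have "entries (Biword ([1], [a])) = [(1, a)]"
      using rep_pi_biword[of a] \<open>a \<noteq> 0\<close> by (simp add: entries_def)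
    then have "Biword ([1], [a]) = w" using a by (simp flip: entries_inject)
    then show ?thesis by (simp only: pi_elt_def l)
  qed
qed

lemma primitives_eq_span_pi:
  "fs.span (pi_elt ` {1..}) = {x \<in> Descd_plus. delta_lt x = 0 \<and> delta_gt x = 0}"
proof (intro equalityI subsetI)
  fix x assume "x \<in> fs.span (pi_elt ` {1..})"
  then show "x \<in> {x \<in> Descd_plus. delta_lt x = 0 \<and> delta_gt x = 0}"
  proof (induction rule: fs.span_induct_alt)
    case base
    show ?case using fs.subspace_0[OF D.subspace_A] by (simp add: delta_lt_def delta_gt_def linear_ext_def)
  next
    case (step c y z)
    then obtain n where n: "n \<ge> 1" "y = pi_elt n" by auto
    let ?u = "Biword ([1], [n])"
    have "bw_length ?u = 1" using rep_pi_biword[OF n(1)] by (simp add: bw_length_def)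
    then have "delta_lt y = 0" "delta_gt y = 0"
      using pos_one[of ?u]
      by (simp_all add: n pi_elt_def delta_lt_def delta_gt_def delta_lt_bw_def delta_gt_bw_def)
    then show ?case
      using step.IH pi_in_Descd[OF n(1)] n(2)
      by (simp add: delta_lt_def delta_gt_def linear_ext_add linear_ext_scale
          fs.subspace_add[OF D.subspace_A] fs.subspace_scale[OF D.subspace_A])
  qed
next
  fix x assume "x \<in> {x \<in> Descd_plus. delta_lt x = 0 \<and> delta_gt x = 0}"
  then have x: "x \<in> Descd_plus" "x \<in> S_plus" "delta_lt x = 0" "delta_gt x = 0"
    using Descd_plus_subset by auto
  have one: "bw_length w = 1" if "w \<in> Poly_Mapping.keys x" for w
  proof (rule ccontr)
    assume "bw_length w \<noteq> 1"
    moreover have "bw_length w > 0" and nz: "Poly_Mapping.lookup x w \<noteq> 0"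
      using that lookup_S_plus_0[OF x(2)] by (auto simp: in_keys_iff)
    moreover from this have "first_letter w = 1 \<or> first_letter w > 1"
      using first_letter_bounds[of w] by linarith
    ultimately show False
      using primitive_coefficient_first_one[OF x(2,3), of w]
        primitive_coefficient_first_gt[OF x(1,4), of w] by fastforce
  qed
  have "x = (\<Sum>w\<in>Poly_Mapping.keys x. qscale (Poly_Mapping.lookup x w) (basis_elt w))"
  proof (rule poly_mapping_eqI)
    fix v
    show "Poly_Mapping.lookup x v =
        Poly_Mapping.lookup (\<Sum>w\<in>Poly_Mapping.keys x. qscale (Poly_Mapping.lookup x w) (basis_elt w)) v"
      by (simp add: lookup_sum lookup_single when_def in_keys_iff if_distrib cong: if_cong)
  qed
  also have "\<dots> \<in> fs.span (pi_elt ` {1..})"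
    by (intro fs.span_sum fs.span_scale fs.span_base) (use pi_elt_basis one in auto)
  finally show "x \<in> fs.span (pi_elt ` {1..})" .
qed

theorem theorem20:
  shows "(inj_on pi_elt {1..} \<and>
          fs.independent (pi_elt ` {1..}) \<and>
          fs.span (pi_elt ` {1..}) = {x \<in> Descd_plus. delta_lt x = 0 \<and> delta_gt x = 0}) \<and>
         free_dendriform_on TYPE('b::ab_group_add) qscale Descd_plus S_lt S_gt {1..} pi_elt"
proof -
  have T: "Node Leaf n Leaf \<in> trees_over {1..}" if "n \<in> {1..}" for n :: nat
    using that by simp
  have pi: "D.tree_monomial pi_elt (Node Leaf n Leaf) = pi_elt n" for n
    by simp
  have inj: "inj_on pi_elt {1..}"
  proof (rule inj_onI)
    fix m n :: nat assume "m \<in> {1..}" "n \<in> {1..}" "pi_elt m = pi_elt n"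
    then have "Node Leaf m Leaf = Node Leaf n Leaf"
      using inj_onD[OF monomials_independent(1) _ T T] unfolding pi by blast
    then show "m = n" by simp
  qed
  have "pi_elt ` {1..} \<subseteq> D.tree_monomial pi_elt ` trees_over {1..}"
    using T pi by (intro image_subsetI image_eqI[of _ _ "Node Leaf n Leaf" for n]) auto
  then have "fs.independent (pi_elt ` {1..})"
    by (rule fs.independent_mono[OF monomials_independent(2)])
  moreover have "free_dendriform_on TYPE('b) qscale Descd_plus S_lt S_gt {1..} pi_elt"
    by (rule D.free_dendriform_onI[OF _ monomials_independent Descd_plus_eq_span_monomials])
       (use pi_in_Descd in auto)
  ultimately show ?thesis
    using inj primitives_eq_span_pi by blast
qed

end
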